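(* Let $(R,\mathfrak{m})$ be a $1$-step normal complete local noetherian integral domain of Krull dimension $1$. Then $\mathfrak{m}\cong\mathfrak{m}^{*}$ as $R$-modules, where $\mathfrak{m}^*=\operatorname{Hom}_R(\mathfrak{m},R)$.
   Context: The normalization $\widetilde R$ is the integral closure of $R$ in its fraction field. $R$ is called $1$-step normal if $\widetilde R\cong \operatorname{End}_R(\mathfrak{m})$ (isomorphism of $R$-algebras). *)

theory Defs
  imports "HOL-Library.Extended_Nat" "HOL-Algebra.Algebra"
begin

section \<open>Local rings, Krull dimension, completeness\<close>

locale local_ring = cring R + maximalideal \<mm> R for R (structure) and \<mm> +
  assumes maximal_unique: "maximalideal J R \<Longrightarrow> J = \<mm>"

text \<open>The supremum of the lengths n of chains P 0 < ... < P n of prime ideals.\<close>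
definition krull_dim :: "('a, 'b) ring_scheme \<Rightarrow> enat" where
  "krull_dim R = Sup {enat n | n. \<exists>P :: nat \<Rightarrow> 'a set.
     (\<forall>i\<le>n. primeideal (P i) R) \<and> (\<forall>i<n. P i \<subset> P (Suc i))}"

definition ideal_power :: "('a, 'b) ring_scheme \<Rightarrow> 'a set \<Rightarrow> nat \<Rightarrow> 'a set" where
  "ideal_power R I n = I [^]\<^bsub>ideals_set R\<^esub> n"

text \<open>The inverse limit of the rings R/I^n. The transition map from R/I^(n+1) to R/I^n
  sends a coset X to I^n + X.\<close>
definition adic_completion :: "('a, 'b) ring_scheme \<Rightarrow> 'a set \<Rightarrow> (nat \<Rightarrow> 'a set) set" where
  "adic_completion R I =
     {c. (\<forall>n. c n \<in> carrier (R Quot ideal_power R I n)) \<and>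
         (\<forall>n. ideal_power R I n <+>\<^bsub>R\<^esub> c (Suc n) = c n)}"

text \<open>Complete means complete and separated: the canonical map to the completion is bijective.\<close>
definition adically_complete :: "('a, 'b) ring_scheme \<Rightarrow> 'a set \<Rightarrow> bool" where
  "adically_complete R I \<longleftrightarrow>
     bij_betw (\<lambda>r n. ideal_power R I n +>\<^bsub>R\<^esub> r) (carrier R) (adic_completion R I)"


section \<open>Fraction field and normalization\<close>

definition frac_rel :: "('a, 'b) ring_scheme \<Rightarrow> (('a \<times> 'a) \<times> ('a \<times> 'a)) set" where
  "frac_rel R = {((a, b), (c, d)).
     a \<in> carrier R \<and> b \<in> carrier R - {\<zero>\<^bsub>R\<^esub>} \<and> c \<in> carrier R \<and> d \<in> carrier R - {\<zero>\<^bsub>R\<^esub>} \<and>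
     a \<otimes>\<^bsub>R\<^esub> d = c \<otimes>\<^bsub>R\<^esub> b}"

definition fraction :: "('a, 'b) ring_scheme \<Rightarrow> 'a \<Rightarrow> 'a \<Rightarrow> ('a \<times> 'a) set" where
  "fraction R a b = frac_rel R `` {(a, b)}"

text \<open>The unions below range over all representatives; for a domain R every choice gives the
  same class, see the lemmas frac_mult and frac_add.\<close>
definition fraction_mult ::
    "('a, 'b) ring_scheme \<Rightarrow> ('a \<times> 'a) set \<Rightarrow> ('a \<times> 'a) set \<Rightarrow> ('a \<times> 'a) set" where
  "fraction_mult R p q =
     (\<Union>(a, b)\<in>p. \<Union>(c, d)\<in>q. fraction R (a \<otimes>\<^bsub>R\<^esub> c) (b \<otimes>\<^bsub>R\<^esub> d))"

definition fraction_add ::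
    "('a, 'b) ring_scheme \<Rightarrow> ('a \<times> 'a) set \<Rightarrow> ('a \<times> 'a) set \<Rightarrow> ('a \<times> 'a) set" where
  "fraction_add R p q =
     (\<Union>(a, b)\<in>p. \<Union>(c, d)\<in>q.
        fraction R (a \<otimes>\<^bsub>R\<^esub> d \<oplus>\<^bsub>R\<^esub> c \<otimes>\<^bsub>R\<^esub> b) (b \<otimes>\<^bsub>R\<^esub> d))"

definition fraction_field :: "('a, 'b) ring_scheme \<Rightarrow> ('a \<times> 'a) set ring" where
  "fraction_field R =
     \<lparr>carrier = (carrier R \<times> (carrier R - {\<zero>\<^bsub>R\<^esub>})) // frac_rel R,
      monoid.mult = fraction_mult R, monoid.one = fraction R \<one>\<^bsub>R\<^esub> \<one>\<^bsub>R\<^esub>,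
      ring.zero = fraction R \<zero>\<^bsub>R\<^esub> \<one>\<^bsub>R\<^esub>, ring.add = fraction_add R\<rparr>"

definition frac_embed :: "('a, 'b) ring_scheme \<Rightarrow> 'a \<Rightarrow> ('a \<times> 'a) set" where
  "frac_embed R r = fraction R r \<one>\<^bsub>R\<^esub>"

definition integral_over :: "('a, 'b) ring_scheme \<Rightarrow> 'a set \<Rightarrow> 'a \<Rightarrow> bool" where
  "integral_over K S x \<longleftrightarrow>
     (\<exists>p \<in> carrier (univ_poly K S). p \<noteq> [] \<and> lead_coeff p = \<one>\<^bsub>K\<^esub> \<and> ring.eval K p x = \<zero>\<^bsub>K\<^esub>)"

definition normalization :: "('a, 'b) ring_scheme \<Rightarrow> ('a, ('a \<times> 'a) set) module" where
  "normalization R =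
     \<lparr>carrier = {x \<in> carrier (fraction_field R).
        integral_over (fraction_field R) (frac_embed R ` carrier R) x},
      monoid.mult = monoid.mult (fraction_field R), monoid.one = monoid.one (fraction_field R),
      ring.zero = ring.zero (fraction_field R), ring.add = ring.add (fraction_field R),
      smult = (\<lambda>r x. frac_embed R r \<otimes>\<^bsub>fraction_field R\<^esub> x)\<rparr>"


section \<open>Homomorphisms of modules and algebras\<close>

text \<open>Linear maps are extensional, so that equality of functions is equality on the carrier.\<close>
definition lin_maps :: "('a, 'r) ring_scheme \<Rightarrow> ('a, 'b, 'm) module_scheme \<Rightarrow>
    ('a, 'c, 'n) module_scheme \<Rightarrow> ('b \<Rightarrow> 'c) set" where
  "lin_maps R M N = {f \<in> carrier M \<rightarrow>\<^sub>E carrier N.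
     (\<forall>x \<in> carrier M. \<forall>y \<in> carrier M. f (x \<oplus>\<^bsub>M\<^esub> y) = f x \<oplus>\<^bsub>N\<^esub> f y) \<and>
     (\<forall>r \<in> carrier R. \<forall>x \<in> carrier M. f (r \<odot>\<^bsub>M\<^esub> x) = r \<odot>\<^bsub>N\<^esub> f x)}"

text \<open>The record type of modules has ring multiplication and unit fields, which are irrelevant
  for a module and left unspecified here.\<close>
definition hom_module :: "('a, 'r) ring_scheme \<Rightarrow> ('a, 'b, 'm) module_scheme \<Rightarrow>
    ('a, 'c, 'n) module_scheme \<Rightarrow> ('a, 'b \<Rightarrow> 'c) module" where
  "hom_module R M N =
     \<lparr>carrier = lin_maps R M N, monoid.mult = undefined, monoid.one = undefined,
      ring.zero = (\<lambda>x\<in>carrier M. \<zero>\<^bsub>N\<^esub>),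
      ring.add = (\<lambda>f g. \<lambda>x\<in>carrier M. f x \<oplus>\<^bsub>N\<^esub> g x),
      smult = (\<lambda>r f. \<lambda>x\<in>carrier M. r \<odot>\<^bsub>N\<^esub> f x)\<rparr>"

definition end_algebra :: "('a, 'r) ring_scheme \<Rightarrow> ('a, 'b, 'm) module_scheme \<Rightarrow>
    ('a, 'b \<Rightarrow> 'b) module" where
  "end_algebra R M =
     (hom_module R M M)\<lparr>monoid.mult := compose (carrier M), monoid.one := (\<lambda>x\<in>carrier M. x)\<rparr>"

definition module_iso :: "('a, 'r) ring_scheme \<Rightarrow> ('a, 'b, 'm) module_scheme \<Rightarrow>
    ('a, 'c, 'n) module_scheme \<Rightarrow> bool" where
  "module_iso R M N \<longleftrightarrow> (\<exists>h \<in> lin_maps R M N. bij_betw h (carrier M) (carrier N))"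

definition algebra_iso :: "('a, 'r) ring_scheme \<Rightarrow> ('a, 'b, 'm) module_scheme \<Rightarrow>
    ('a, 'c, 'n) module_scheme \<Rightarrow> bool" where
  "algebra_iso R A B \<longleftrightarrow> (\<exists>h \<in> ring_iso A B.
     \<forall>r \<in> carrier R. \<forall>x \<in> carrier A. h (r \<odot>\<^bsub>A\<^esub> x) = r \<odot>\<^bsub>B\<^esub> h x)"

definition ideal_module :: "('a, 'b) ring_scheme \<Rightarrow> 'a set \<Rightarrow> ('a, 'a) module" where
  "ideal_module R I =
     \<lparr>carrier = I, monoid.mult = monoid.mult R, monoid.one = monoid.one R,
      ring.zero = ring.zero R, ring.add = ring.add R, smult = monoid.mult R\<rparr>"

definition dual_module :: "('a, 'r) ring_scheme \<Rightarrow> ('a, 'b, 'm) module_scheme \<Rightarrow>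
    ('a, 'b \<Rightarrow> 'a) module" where
  "dual_module R M = hom_module R M (ideal_module R (carrier R))"

definition one_step_normal :: "('a, 'b) ring_scheme \<Rightarrow> 'a set \<Rightarrow> bool" where
  "one_step_normal R \<mm> \<longleftrightarrow> algebra_iso R (normalization R) (end_algebra R (ideal_module R \<mm>))"


section \<open>The fraction field is a field containing R\<close>

context domain
begin

lemma frac_rel_iff:
  "((a, b), (c, d)) \<in> frac_rel R \<longleftrightarrow>
     a \<in> carrier R \<and> b \<in> carrier R - {\<zero>} \<and> c \<in> carrier R \<and> d \<in> carrier R - {\<zero>} \<and> a \<otimes> d = c \<otimes> b"
  by (simp add: frac_rel_def)

lemma equiv_frac_rel: "equiv (carrier R \<times> (carrier R - {\<zero>})) (frac_rel R)"
proof (rule equivI)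
  show "refl_on (carrier R \<times> (carrier R - {\<zero>})) (frac_rel R)"
    by (auto simp: refl_on_def frac_rel_def)
  show "frac_rel R \<subseteq> (carrier R \<times> (carrier R - {\<zero>})) \<times> (carrier R \<times> (carrier R - {\<zero>}))"
    by (auto simp: frac_rel_def)
  show "sym (frac_rel R)"
    by (auto simp: sym_def frac_rel_def)
  show "trans (frac_rel R)"
  proof (rule transI, clarify)
    fix a b c d e f
    assume "((a, b), (c, d)) \<in> frac_rel R" "((c, d), (e, f)) \<in> frac_rel R"
    then have cl: "a \<in> carrier R" "b \<in> carrier R" "c \<in> carrier R" "d \<in> carrier R"
        "e \<in> carrier R" "f \<in> carrier R" "b \<noteq> \<zero>" "d \<noteq> \<zero>" "f \<noteq> \<zero>"
      and eq: "a \<otimes> d = c \<otimes> b" "c \<otimes> f = e \<otimes> d"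
      by (auto simp: frac_rel_iff)
    have "d \<otimes> (a \<otimes> f) = (a \<otimes> d) \<otimes> f" using cl by (simp add: m_ac)
    also have "\<dots> = (c \<otimes> f) \<otimes> b" unfolding eq(1) using cl by (simp add: m_ac)
    also have "\<dots> = d \<otimes> (e \<otimes> b)" unfolding eq(2) using cl by (simp add: m_ac)
    finally have "a \<otimes> f = e \<otimes> b" using cl m_lcancel by simp
    then show "((a, b), (e, f)) \<in> frac_rel R" using cl by (simp add: frac_rel_iff)
  qed
qed

lemma frac_eq_iff:
  assumes "a \<in> carrier R" "b \<in> carrier R - {\<zero>}" "c \<in> carrier R" "d \<in> carrier R - {\<zero>}"
  shows "fraction R a b = fraction R c d \<longleftrightarrow> a \<otimes> d = c \<otimes> b"
  using assms eq_equiv_class_iff[OF equiv_frac_rel, of "(a, b)" "(c, d)"]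
  by (simp add: fraction_def frac_rel_iff)

lemma frac_closed:
  assumes "a \<in> carrier R" "b \<in> carrier R - {\<zero>}"
  shows "fraction R a b \<in> carrier (fraction_field R)"
  using assms by (auto simp: fraction_field_def fraction_def intro!: quotientI)

lemma frac_cases:
  assumes "x \<in> carrier (fraction_field R)"
  obtains a b where "a \<in> carrier R" "b \<in> carrier R" "b \<noteq> \<zero>" "x = fraction R a b"
  using assms by (auto simp: fraction_field_def fraction_def elim!: quotientE)

lemma UN_frac:
  assumes ab: "a \<in> carrier R" "b \<in> carrier R - {\<zero>}" and cd: "c \<in> carrier R" "d \<in> carrier R - {\<zero>}"
    and resp: "\<And>a' b' c' d'. ((a, b), (a', b')) \<in> frac_rel R \<Longrightarrow> ((c, d), (c', d')) \<in> frac_rel R \<Longrightarrow>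
      F a' b' c' d' = F a b c d"
  shows "(\<Union>(a', b')\<in>fraction R a b. \<Union>(c', d')\<in>fraction R c d. F a' b' c' d') = F a b c d"
proof -
  have "(a, b) \<in> fraction R a b" "(c, d) \<in> fraction R c d"
    using ab cd by (auto simp: fraction_def frac_rel_iff)
  moreover have "(case p of (a', b') \<Rightarrow> \<Union>(c', d')\<in>fraction R c d. F a' b' c' d') = F a b c d"
    if p: "p \<in> fraction R a b" for p
  proof -
    obtain a' b' where p': "p = (a', b')" by (cases p)
    have "(case q of (c', d') \<Rightarrow> F a' b' c' d') = F a b c d" if "q \<in> fraction R c d" for q
      using p that resp by (cases q) (simp add: p' fraction_def)
    with \<open>(c, d) \<in> fraction R c d\<close> show ?thesis by (auto simp: p')
  qed
  ultimately show ?thesis by auto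
qed

lemma frac_mult:
  assumes ab: "a \<in> carrier R" "b \<in> carrier R - {\<zero>}" and cd: "c \<in> carrier R" "d \<in> carrier R - {\<zero>}"
  shows "fraction R a b \<otimes>\<^bsub>fraction_field R\<^esub> fraction R c d = fraction R (a \<otimes> c) (b \<otimes> d)"
proof -
  have "fraction R (a' \<otimes> c') (b' \<otimes> d') = fraction R (a \<otimes> c) (b \<otimes> d)"
    if "((a, b), (a', b')) \<in> frac_rel R" "((c, d), (c', d')) \<in> frac_rel R" for a' b' c' d'
  proof -
    have cl: "a \<in> carrier R" "b \<in> carrier R" "c \<in> carrier R" "d \<in> carrier R" "b \<noteq> \<zero>" "d \<noteq> \<zero>"
        "a' \<in> carrier R" "b' \<in> carrier R" "c' \<in> carrier R" "d' \<in> carrier R" "b' \<noteq> \<zero>" "d' \<noteq> \<zero>"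
      and eq: "a \<otimes> b' = a' \<otimes> b" "c \<otimes> d' = c' \<otimes> d"
      using that by (auto simp: frac_rel_iff)
    have "(a' \<otimes> c') \<otimes> (b \<otimes> d) = (a' \<otimes> b) \<otimes> (c' \<otimes> d)" using cl by (simp add: m_ac)
    also have "\<dots> = (a \<otimes> c) \<otimes> (b' \<otimes> d')" unfolding eq[symmetric] using cl by (simp add: m_ac)
    finally show ?thesis using cl by (subst frac_eq_iff) (auto simp: integral_iff)
  qed
  then show ?thesis
    using UN_frac[OF ab cd, of "\<lambda>a b c d. fraction R (a \<otimes> c) (b \<otimes> d)"]
    by (simp add: fraction_field_def fraction_mult_def fraction_add_def)
qed

lemma frac_add:
  assumes ab: "a \<in> carrier R" "b \<in> carrier R - {\<zero>}" and cd: "c \<in> carrier R" "d \<in> carrier R - {\<zero>}"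
  shows "fraction R a b \<oplus>\<^bsub>fraction_field R\<^esub> fraction R c d = fraction R (a \<otimes> d \<oplus> c \<otimes> b) (b \<otimes> d)"
proof -
  have "fraction R (a' \<otimes> d' \<oplus> c' \<otimes> b') (b' \<otimes> d') = fraction R (a \<otimes> d \<oplus> c \<otimes> b) (b \<otimes> d)"
    if "((a, b), (a', b')) \<in> frac_rel R" "((c, d), (c', d')) \<in> frac_rel R" for a' b' c' d'
  proof -
    have cl: "a \<in> carrier R" "b \<in> carrier R" "c \<in> carrier R" "d \<in> carrier R" "b \<noteq> \<zero>" "d \<noteq> \<zero>"
        "a' \<in> carrier R" "b' \<in> carrier R" "c' \<in> carrier R" "d' \<in> carrier R" "b' \<noteq> \<zero>" "d' \<noteq> \<zero>"
      and eq: "a \<otimes> b' = a' \<otimes> b" "c \<otimes> d' = c' \<otimes> d"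
      using that by (auto simp: frac_rel_iff)
    have "(a' \<otimes> d' \<oplus> c' \<otimes> b') \<otimes> (b \<otimes> d) = (a' \<otimes> b) \<otimes> (d' \<otimes> d) \<oplus> (c' \<otimes> d) \<otimes> (b' \<otimes> b)"
      using cl by (simp add: l_distr r_distr m_ac)
    also have "\<dots> = (a \<otimes> d \<oplus> c \<otimes> b) \<otimes> (b' \<otimes> d')"
      unfolding eq[symmetric] using cl by (simp add: l_distr r_distr m_ac)
    finally show ?thesis using cl by (subst frac_eq_iff) (auto simp: integral_iff)
  qed
  then show ?thesis
    using UN_frac[OF ab cd, of "\<lambda>a b c d. fraction R (a \<otimes> d \<oplus> c \<otimes> b) (b \<otimes> d)"]
    by (simp add: fraction_field_def fraction_mult_def fraction_add_def)
qed

lemma frac_zero: "\<zero>\<^bsub>fraction_field R\<^esub> = fraction R \<zero> \<one>" and frac_one: "\<one>\<^bsub>fraction_field R\<^esub> = fraction R \<one> \<one>"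
  by (simp_all add: fraction_field_def)

lemma cring_fraction_field: "cring (fraction_field R)"
proof (rule cringI)
  show "abelian_group (fraction_field R)"
  proof (rule abelian_groupI)
    fix x assume "x \<in> carrier (fraction_field R)"
    then obtain a b where ab: "a \<in> carrier R" "b \<in> carrier R" "b \<noteq> \<zero>" "x = fraction R a b"
      by (rule frac_cases)
    show "\<zero>\<^bsub>fraction_field R\<^esub> \<oplus>\<^bsub>fraction_field R\<^esub> x = x"
      using ab by (simp add: frac_zero frac_add)
    have "fraction R (\<ominus> a) b \<oplus>\<^bsub>fraction_field R\<^esub> x = \<zero>\<^bsub>fraction_field R\<^esub>"
      using ab by (simp add: frac_zero frac_add frac_eq_iff integral_iff l_minus l_neg)
    then show "\<exists>y\<in>carrier (fraction_field R). y \<oplus>\<^bsub>fraction_field R\<^esub> x = \<zero>\<^bsub>fraction_field R\<^esub>"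
      using ab by (intro bexI[of _ "fraction R (\<ominus> a) b"] frac_closed) auto
    fix y assume "y \<in> carrier (fraction_field R)"
    then obtain c d where cd: "c \<in> carrier R" "d \<in> carrier R" "d \<noteq> \<zero>" "y = fraction R c d"
      by (rule frac_cases)
    show "x \<oplus>\<^bsub>fraction_field R\<^esub> y \<in> carrier (fraction_field R)"
      using ab cd by (simp add: frac_add frac_closed integral_iff)
    show "x \<oplus>\<^bsub>fraction_field R\<^esub> y = y \<oplus>\<^bsub>fraction_field R\<^esub> x"
      using ab cd by (simp add: frac_add m_ac a_ac)
    fix z assume "z \<in> carrier (fraction_field R)"
    then obtain e f where ef: "e \<in> carrier R" "f \<in> carrier R" "f \<noteq> \<zero>" "z = fraction R e f"
      by (rule frac_cases)
    show "x \<oplus>\<^bsub>fraction_field R\<^esub> y \<oplus>\<^bsub>fraction_field R\<^esub> z =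
        x \<oplus>\<^bsub>fraction_field R\<^esub> (y \<oplus>\<^bsub>fraction_field R\<^esub> z)"
    proof -
      have "(a \<otimes> d \<oplus> c \<otimes> b) \<otimes> f \<oplus> e \<otimes> (b \<otimes> d) =
          a \<otimes> (d \<otimes> f) \<oplus> (c \<otimes> f \<oplus> e \<otimes> d) \<otimes> b"
        using ab cd ef by (simp add: l_distr r_distr m_ac a_ac)
      then show ?thesis
        using ab cd ef by (simp add: frac_add integral_iff m_assoc)
    qed
  qed (simp add: frac_zero frac_closed)
next
  show "comm_monoid (fraction_field R)"
  proof (rule comm_monoidI)
    fix x assume "x \<in> carrier (fraction_field R)"
    then obtain a b where ab: "a \<in> carrier R" "b \<in> carrier R" "b \<noteq> \<zero>" "x = fraction R a b"
      by (rule frac_cases)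
    show "\<one>\<^bsub>fraction_field R\<^esub> \<otimes>\<^bsub>fraction_field R\<^esub> x = x"
      using ab by (simp add: frac_one frac_mult)
    fix y assume "y \<in> carrier (fraction_field R)"
    then obtain c d where cd: "c \<in> carrier R" "d \<in> carrier R" "d \<noteq> \<zero>" "y = fraction R c d"
      by (rule frac_cases)
    show "x \<otimes>\<^bsub>fraction_field R\<^esub> y \<in> carrier (fraction_field R)"
      using ab cd by (simp add: frac_mult frac_closed integral_iff)
    show "x \<otimes>\<^bsub>fraction_field R\<^esub> y = y \<otimes>\<^bsub>fraction_field R\<^esub> x"
      using ab cd by (simp add: frac_mult m_ac)
    fix z assume "z \<in> carrier (fraction_field R)"
    then obtain e f where ef: "e \<in> carrier R" "f \<in> carrier R" "f \<noteq> \<zero>" "z = fraction R e f"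
      by (rule frac_cases)
    show "x \<otimes>\<^bsub>fraction_field R\<^esub> y \<otimes>\<^bsub>fraction_field R\<^esub> z =
        x \<otimes>\<^bsub>fraction_field R\<^esub> (y \<otimes>\<^bsub>fraction_field R\<^esub> z)"
      using ab cd ef by (simp add: frac_mult integral_iff m_ac)
  qed (simp add: frac_one frac_closed)
next
  fix x y z
  assume xyz: "x \<in> carrier (fraction_field R)" "y \<in> carrier (fraction_field R)"
    "z \<in> carrier (fraction_field R)"
  obtain a b where ab: "a \<in> carrier R" "b \<in> carrier R" "b \<noteq> \<zero>" "x = fraction R a b"
    using xyz(1) by (rule frac_cases)
  obtain c d where cd: "c \<in> carrier R" "d \<in> carrier R" "d \<noteq> \<zero>" "y = fraction R c d"
    using xyz(2) by (rule frac_cases)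
  obtain e f where ef: "e \<in> carrier R" "f \<in> carrier R" "f \<noteq> \<zero>" "z = fraction R e f"
    using xyz(3) by (rule frac_cases)
  have "((a \<otimes> d \<oplus> c \<otimes> b) \<otimes> e) \<otimes> ((b \<otimes> f) \<otimes> (d \<otimes> f)) =
      ((a \<otimes> e) \<otimes> (d \<otimes> f) \<oplus> (c \<otimes> e) \<otimes> (b \<otimes> f)) \<otimes> ((b \<otimes> d) \<otimes> f)"
    using ab cd ef by (simp add: l_distr r_distr m_ac)
  then show "(x \<oplus>\<^bsub>fraction_field R\<^esub> y) \<otimes>\<^bsub>fraction_field R\<^esub> z =
      x \<otimes>\<^bsub>fraction_field R\<^esub> z \<oplus>\<^bsub>fraction_field R\<^esub> y \<otimes>\<^bsub>fraction_field R\<^esub> z"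
    using ab cd ef by (simp add: frac_add frac_mult integral_iff frac_eq_iff)
qed

lemma field_fraction_field: "field (fraction_field R)"
proof (rule cring.cring_fieldI2[OF cring_fraction_field])
  show "\<zero>\<^bsub>fraction_field R\<^esub> \<noteq> \<one>\<^bsub>fraction_field R\<^esub>"
    by (simp add: frac_zero frac_one frac_eq_iff)
  fix x assume x: "x \<in> carrier (fraction_field R)" "x \<noteq> \<zero>\<^bsub>fraction_field R\<^esub>"
  then obtain a b where ab: "a \<in> carrier R" "b \<in> carrier R" "b \<noteq> \<zero>" "x = fraction R a b"
    by (elim frac_cases)
  with x have "a \<noteq> \<zero>" by (auto simp: frac_zero frac_eq_iff)
  then show "\<exists>y\<in>carrier (fraction_field R). x \<otimes>\<^bsub>fraction_field R\<^esub> y = \<one>\<^bsub>fraction_field R\<^esub>"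
    using ab by (intro bexI[of _ "fraction R b a"] frac_closed)
      (auto simp: frac_mult frac_one frac_eq_iff integral_iff m_ac)
qed

lemma frac_embed_hom: "frac_embed R \<in> ring_hom R (fraction_field R)"
  by (rule ring_hom_memI) (auto simp: frac_embed_def frac_closed frac_mult frac_add frac_one)

lemma frac_embed_inj: "inj_on (frac_embed R) (carrier R)"
  by (rule inj_onI) (simp add: frac_embed_def frac_eq_iff)

end

end

(*
  Inside the fraction field K the dual of m is (R : m), and an R-algebra isomorphism between the
  normalization and End(m) forces the normalization to equal S = (m : m). If (R : m) is larger
  than S, then m is principal in R and m is isomorphic to R, hence to its dual. Otherwise the dual
  is S, and it remains to see that the S-ideal m is principal: S is noetherian, integrally closed,
  and its nonzero primes are maximal, contain m, and are finite in number, so m is invertible over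
  a semilocal Dedekind domain. Concretely one finds b in (S : m) such that b m lies in no nonzero
  prime of S, whence b m = S.
*)

theory Submission
  imports Defs
begin

text \<open>Every finiteness argument below has one form: a family of \<open>A\<close>-submodules of
  \<open>K\<close> with a common denominator has a maximal member. This reaches \<open>S\<close>
  because x S \<subseteq> \<mm> \<subseteq> A for any nonzero x in \<mm>, so \<open>S\<close> is
  itself a fractional ideal of \<open>A\<close>. Integral equations, conductors equal to a given
  prime and the finiteness of the set of primes all come out of such a maximal choice. Integrality
  works in two directions. An element of \<open>S\<close> maps \<mm> into itself, hence is integral
  over \<open>A\<close>; so distinct nonzero primes of \<open>S\<close>, all lying over \<mm>, are
  incomparable. Conversely, an element stabilizing a nonzero ideal of \<open>S\<close> is integral
  over \<open>A\<close>, hence in \<open>S\<close> by 1-step normality; this is what makes \<mm>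
  invertible at each prime. Both cases of the overview end in the same equation \<mm> = u (A :
  \<mm>) with u nonzero in \<open>K\<close>, and division by u is then an isomorphism from \<mm> to
  its dual.\<close>

text \<open>Modules are plain subsets of one ambient ring, with the scalars given as a set, so that
  the same set can be viewed over \<open>A\<close> or over \<open>S\<close> without building a ring
  record for either. Negatives come from the scalar -1 once \<open>B\<close> contains it.\<close>

definition submod :: "('a, 'b) ring_scheme \<Rightarrow> 'a set \<Rightarrow> 'a set \<Rightarrow> bool" where
  "submod K B N \<longleftrightarrow> N \<subseteq> carrier K \<and> \<zero>\<^bsub>K\<^esub> \<in> N \<and> (\<forall>x\<in>N. \<forall>y\<in>N. x \<oplus>\<^bsub>K\<^esub> y \<in> N) \<and>
     (\<forall>b\<in>B. \<forall>x\<in>N. b \<otimes>\<^bsub>K\<^esub> x \<in> N)"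

lemma submodI:
  assumes "\<And>x. x \<in> N \<Longrightarrow> x \<in> carrier K" "\<zero>\<^bsub>K\<^esub> \<in> N"
    "\<And>x y. x \<in> N \<Longrightarrow> y \<in> N \<Longrightarrow> x \<oplus>\<^bsub>K\<^esub> y \<in> N"
    "\<And>b x. b \<in> B \<Longrightarrow> x \<in> N \<Longrightarrow> b \<otimes>\<^bsub>K\<^esub> x \<in> N"
  shows "submod K B N"
  using assms by (auto simp: submod_def)

lemma submodD:
  assumes "submod K B N"
  shows "x \<in> N \<Longrightarrow> x \<in> carrier K" "\<zero>\<^bsub>K\<^esub> \<in> N"
    "x \<in> N \<Longrightarrow> y \<in> N \<Longrightarrow> x \<oplus>\<^bsub>K\<^esub> y \<in> N"
    "b \<in> B \<Longrightarrow> x \<in> N \<Longrightarrow> b \<otimes>\<^bsub>K\<^esub> x \<in> N"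
  using assms by (auto simp: submod_def)

lemma submod_mono: "submod K B N \<Longrightarrow> A \<subseteq> B \<Longrightarrow> submod K A N"
  by (auto simp: submod_def)

section \<open>The abstract setting: a one-dimensional local domain inside its fraction
  field\<close>

text \<open>The values at \<open>y\<close> of the monic polynomials with coefficients in \<open>A\<close>, built by Horner's scheme.\<close>
inductive_set monic_values :: "('a, 'b) ring_scheme \<Rightarrow> 'a set \<Rightarrow> 'a \<Rightarrow> 'a set"
  for K (structure) and A y where
  one: "\<one> \<in> monic_values K A y"
| step: "w \<in> monic_values K A y \<Longrightarrow> r \<in> A \<Longrightarrow> y \<otimes> w \<oplus> r \<in> monic_values K A y"

text \<open>The assumption \<open>normal\<close> is what 1-step normality amounts to: the normalization is contained in
  \<open>(\<mm> : \<mm>)\<close>. The reverse inclusion holds for every noetherian \<open>A\<close>.\<close>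
locale one_dim_local = field K for K (structure) +
  fixes A \<mm>
  assumes A_subring: "subring A K"
    and denominator: "x \<in> carrier K \<Longrightarrow> \<exists>b\<in>A - {\<zero>}. b \<otimes> x \<in> A"
    and acc: "\<C> \<noteq> {} \<Longrightarrow> (\<And>I. I \<in> \<C> \<Longrightarrow> submod K A I \<and> I \<subseteq> A) \<Longrightarrow>
      \<exists>M\<in>\<C>. \<forall>I\<in>\<C>. M \<subseteq> I \<longrightarrow> I = M"
    and m_submod: "submod K A \<mm>" and m_subset: "\<mm> \<subseteq> A" and m_nonzero: "\<exists>x\<in>\<mm>. x \<noteq> \<zero>"
    and m_proper: "\<one> \<notin> \<mm>"
    and units: "a \<in> A \<Longrightarrow> a \<notin> \<mm> \<Longrightarrow> \<exists>c\<in>A. c \<otimes> a = \<one>"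
    and dim: "submod K A P \<Longrightarrow> P \<subseteq> A \<Longrightarrow> \<exists>x\<in>P. x \<noteq> \<zero> \<Longrightarrow> \<one> \<notin> P \<Longrightarrow>
      (\<And>a b. a \<in> A \<Longrightarrow> b \<in> A \<Longrightarrow> a \<otimes> b \<in> P \<Longrightarrow> a \<in> P \<or> b \<in> P) \<Longrightarrow> P = \<mm>"
    and normal: "y \<in> carrier K \<Longrightarrow> \<zero> \<in> monic_values K A y \<Longrightarrow> x \<in> \<mm> \<Longrightarrow> y \<otimes> x \<in> \<mm>"
begin

lemma A_closed: "a \<in> A \<Longrightarrow> a \<in> carrier K" "\<zero> \<in> A" "\<one> \<in> A" "a \<in> A \<Longrightarrow> \<ominus> a \<in> A"
  "a \<in> A \<Longrightarrow> b \<in> A \<Longrightarrow> a \<oplus> b \<in> A" "a \<in> A \<Longrightarrow> b \<in> A \<Longrightarrow> a \<otimes> b \<in> A"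
  using subringE[OF A_subring] by auto

lemma submod_minus:
  assumes N: "submod K A N" and x: "x \<in> N" shows "\<ominus> x \<in> N"
proof -
  have "(\<ominus> \<one>) \<otimes> x \<in> N" using submodD(4)[OF N _ x] A_closed by blast
  then show ?thesis using submodD(1)[OF N x] by (simp add: l_minus)
qed

section \<open>Maximal fractional modules and integral equations\<close>

text \<open>Multiplication by c is injective and carries the whole family into ideals of
  \<open>A\<close>, where \<open>acc\<close> applies. The same c must serve every member of the
  family.\<close>

lemma acc_fractional:
  assumes ne: "\<C> \<noteq> {}" and c: "c \<in> carrier K" "c \<noteq> \<zero>"
    and \<C>: "\<And>N. N \<in> \<C> \<Longrightarrow> submod K A N" "\<And>N x. N \<in> \<C> \<Longrightarrow> x \<in> N \<Longrightarrow> c \<otimes> x \<in> A"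
  shows "\<exists>M\<in>\<C>. \<forall>N\<in>\<C>. M \<subseteq> N \<longrightarrow> N = M"
proof -
  have "\<exists>M\<in>(\<lambda>N. (\<otimes>) c ` N) ` \<C>. \<forall>I\<in>(\<lambda>N. (\<otimes>) c ` N) ` \<C>. M \<subseteq> I \<longrightarrow> I = M"
  proof (rule acc)
    show "(\<lambda>N. (\<otimes>) c ` N) ` \<C> \<noteq> {}" using ne by simp
    fix I assume "I \<in> (\<lambda>N. (\<otimes>) c ` N) ` \<C>"
    then obtain N where N: "N \<in> \<C>" "I = (\<otimes>) c ` N" by auto
    note NK = \<C>(1)[OF N(1)]
    have "submod K A I"
    proof (rule submodI)
      show "\<zero> \<in> I" using submodD(2)[OF NK] c unfolding N(2) by (intro image_eqI[of _ _ \<zero>]) auto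
      fix x assume "x \<in> I"
      then obtain u where u: "u \<in> N" "x = c \<otimes> u" by (auto simp: N)
      note uK = submodD(1)[OF NK u(1)]
      show "x \<in> carrier K" using u uK c by simp
      { fix y assume "y \<in> I"
        then obtain v where v: "v \<in> N" "y = c \<otimes> v" by (auto simp: N)
        have "x \<oplus> y = c \<otimes> (u \<oplus> v)" using u v uK submodD(1)[OF NK v(1)] c by (simp add: r_distr)
        then show "x \<oplus> y \<in> I" using submodD(3)[OF NK u(1) v(1)] by (auto simp: N) }
      { fix b assume b: "b \<in> A"
        have "b \<otimes> x = c \<otimes> (b \<otimes> u)" using u uK c A_closed(1)[OF b] by (simp add: m_ac)
        then show "b \<otimes> x \<in> I" using submodD(4)[OF NK b u(1)] by (auto simp: N) }
    qed
    moreover have "I \<subseteq> A" using \<C>(2)[OF N(1)] N by auto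
    ultimately show "submod K A I \<and> I \<subseteq> A" by simp
  qed
  then obtain M where M: "M \<in> \<C>" "\<And>N. N \<in> \<C> \<Longrightarrow> (\<otimes>) c ` M \<subseteq> (\<otimes>) c ` N \<Longrightarrow> (\<otimes>) c ` N = (\<otimes>) c ` M"
    by auto
  have inj: "inj_on ((\<otimes>) c) (carrier K)" using c by (auto intro!: inj_onI simp: m_lcancel)
  have "N = M" if N: "N \<in> \<C>" "M \<subseteq> N" for N
  proof -
    have "(\<otimes>) c ` N = (\<otimes>) c ` M" using M(2)[OF N(1)] N(2) by blast
    moreover have "N \<subseteq> carrier K" "M \<subseteq> carrier K"
      using submodD(1)[OF \<C>(1)] N M(1) by blast+
    ultimately show ?thesis using inj inj_on_image_eq_iff by blast
  qed
  with M(1) show ?thesis by blast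
qed

text \<open>Noetherian substitute for the determinant trick: the \<open>A\<close>-modules spanned by the powers of \<open>y\<close>
  up to degree \<open>n\<close> stabilise.\<close>
lemma zero_monic_value:
  assumes y: "y \<in> carrier K" and N: "submod K A N" and c: "c \<in> carrier K" "c \<noteq> \<zero>"
    and cN: "\<And>x. x \<in> N \<Longrightarrow> c \<otimes> x \<in> A" and x: "x \<in> N" "x \<noteq> \<zero>"
    and yN: "\<And>x. x \<in> N \<Longrightarrow> y \<otimes> x \<in> N"
  shows "\<zero> \<in> monic_values K A y"
proof -
  \<comment> \<open>U n is A + y A + ... + y^n A, written in Horner form so that its elements fit
    the rule \<open>monic_values.step\<close>.\<close>
  define U where "U n = rec_nat A (\<lambda>_ V. {y \<otimes> u \<oplus> r | u r. u \<in> V \<and> r \<in> A}) n" for n :: nat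
  have U0: "U 0 = A" and US: "U (Suc n) = {y \<otimes> u \<oplus> r | u r. u \<in> U n \<and> r \<in> A}" for n
    by (simp_all add: U_def)
  have U: "submod K A (U n)" for n
  proof (induct n)
    case 0 then show ?case by (auto simp: U0 intro!: submodI A_closed)
  next
    case (Suc n)
    show ?case
    proof (rule submodI)
      have "\<zero> = y \<otimes> \<zero> \<oplus> \<zero>" using y by simp
      then show "\<zero> \<in> U (Suc n)" using submodD(2)[OF Suc] A_closed(2) unfolding US by blast
      fix z assume "z \<in> U (Suc n)"
      then obtain u r where u: "u \<in> U n" "r \<in> A" "z = y \<otimes> u \<oplus> r" by (auto simp: US)
      have uK: "u \<in> carrier K" "r \<in> carrier K" using submodD(1)[OF Suc u(1)] A_closed(1) u by auto
      show "z \<in> carrier K" using u uK y by simp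
      { fix z' assume "z' \<in> U (Suc n)"
        then obtain v s where v: "v \<in> U n" "s \<in> A" "z' = y \<otimes> v \<oplus> s" by (auto simp: US)
        have vK: "v \<in> carrier K" "s \<in> carrier K" using submodD(1)[OF Suc v(1)] A_closed(1) v by auto
        have "z \<oplus> z' = y \<otimes> (u \<oplus> v) \<oplus> (r \<oplus> s)" using u v uK vK y by (simp add: r_distr a_ac)
        then show "z \<oplus> z' \<in> U (Suc n)" unfolding US
          using submodD(3)[OF Suc u(1) v(1)] A_closed(5)[OF u(2) v(2)] by blast }
      { fix b assume b: "b \<in> A"
        have "b \<otimes> z = y \<otimes> (b \<otimes> u) \<oplus> b \<otimes> r"
          using u uK y A_closed(1)[OF b] by (simp add: r_distr m_ac)
        then show "b \<otimes> z \<in> U (Suc n)" unfolding US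
          using submodD(4)[OF Suc b u(1)] A_closed(6)[OF b u(2)] by blast }
    qed
  qed
  have xK: "x \<in> carrier K" using submodD(1)[OF N x(1)] .
  have UN: "u \<in> U n \<Longrightarrow> u \<otimes> x \<in> N" for u n
  proof (induct n arbitrary: u)
    case 0 then show ?case using submodD(4)[OF N _ x(1)] by (simp add: U0)
  next
    case (Suc n)
    then obtain v r where v: "v \<in> U n" "r \<in> A" "u = y \<otimes> v \<oplus> r" by (auto simp: US)
    have vK: "v \<in> carrier K" "r \<in> carrier K" using submodD(1)[OF U v(1)] A_closed(1) v by auto
    have "u \<otimes> x = y \<otimes> (v \<otimes> x) \<oplus> r \<otimes> x" using v vK y xK by (simp add: l_distr m_assoc)
    then show ?case using yN[OF Suc(1)[OF v(1)]] submodD(4)[OF N v(2) x(1)] submodD(3)[OF N] by simp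
  qed
  have "\<exists>M\<in>range U. \<forall>N\<in>range U. M \<subseteq> N \<longrightarrow> N = M"
  \<comment> \<open>Every U n multiplies x into N, and c multiplies N into A; hence c x is a
    denominator for all n at once.\<close>
  proof (rule acc_fractional[of _ "c \<otimes> x"])
    show "c \<otimes> x \<in> carrier K" "c \<otimes> x \<noteq> \<zero>" using c x xK by (auto simp: integral_iff)
    fix M u assume M: "M \<in> range U" "u \<in> M"
    then obtain n where n: "u \<in> U n" by auto
    have "c \<otimes> x \<otimes> u = c \<otimes> (u \<otimes> x)" using c xK submodD(1)[OF U n] by (simp add: m_ac)
    then show "c \<otimes> x \<otimes> u \<in> A" using cN[OF UN[OF n]] by simp
  qed (use U in auto)
  then obtain n where n: "\<forall>N\<in>range U. U n \<subseteq> N \<longrightarrow> N = U n" by (elim bexE) auto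
  have mono: "u \<in> U k \<Longrightarrow> u \<in> U (Suc k)" for u k
  proof (induct k arbitrary: u)
    case 0
    then have "u = y \<otimes> \<zero> \<oplus> u" using y A_closed(1) by (simp add: U0)
    then show ?case using 0 A_closed(2) unfolding US U0 by blast
  next
    case (Suc k)
    then obtain v r where v: "v \<in> U k" "r \<in> A" "u = y \<otimes> v \<oplus> r" by (auto simp: US)
    then show ?case using Suc(1)[OF v(1)] unfolding US[of "Suc k"] by blast
  qed
  have eq: "U (Suc n) = U n" by (rule n[rule_format]) (use mono in auto)
  have pow: "y [^] k \<in> U k" for k :: nat
  proof (induct k)
    case 0 then show ?case using A_closed by (simp add: U0)
  next
    case (Suc k)
    have "y [^] Suc k = y \<otimes> y [^] k \<oplus> \<zero>" using y by (simp add: m_comm)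
    then show ?case using Suc A_closed(2) unfolding US by blast
  qed
  \<comment> \<open>Adding an element of degree at most k to y^(k+1) gives the value of a monic
    polynomial of degree k+1.\<close>
  have W: "u \<in> U k \<Longrightarrow> y [^] Suc k \<oplus> u \<in> monic_values K A y" for u k
  proof (induct k arbitrary: u)
    case 0
    then show ?case using monic_values.step[OF monic_values.one, of u A K y] y by (simp add: U0)
  next
    case (Suc k)
    then obtain v r where v: "v \<in> U k" "r \<in> A" "u = y \<otimes> v \<oplus> r" by (auto simp: US)
    have vK: "v \<in> carrier K" "r \<in> carrier K" using submodD(1)[OF U v(1)] A_closed(1) v by auto
    have "y [^] Suc (Suc k) \<oplus> u = y \<otimes> y [^] Suc k \<oplus> (y \<otimes> v \<oplus> r)"
      unfolding v(3) nat_pow_Suc2[OF y, of "Suc k"] ..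
    also have "\<dots> = y \<otimes> (y [^] Suc k \<oplus> v) \<oplus> r"
      using vK y by (simp add: r_distr a_assoc del: nat_pow_Suc)
    finally have "y [^] Suc (Suc k) \<oplus> u = y \<otimes> (y [^] Suc k \<oplus> v) \<oplus> r" .
    then show ?case using monic_values.step[OF Suc(1)[OF v(1)] v(2)] by (simp del: nat_pow_Suc)
  qed
  \<comment> \<open>By stabilization y^(n+1) lies in U n, so its negative is a legitimate choice of
    lower-order terms, and the monic value becomes zero.\<close>
  have "\<ominus> (y [^] Suc n) \<in> U n" using pow[of "Suc n"] eq submod_minus[OF U] by simp
  from W[OF this] show ?thesis using y by (simp add: r_neg del: nat_pow_Suc)
qed

section \<open>The ring S = (m : m) is noetherian and integrally closed\<close>

text \<open>The endomorphism ring of \<open>\<mm>\<close>, realised inside \<open>K\<close> as \<open>(\<mm> : \<mm>)\<close>.\<close>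
definition S where "S = {y \<in> carrier K. \<forall>x\<in>\<mm>. y \<otimes> x \<in> \<mm>}"

lemma m_closed': "x \<in> \<mm> \<Longrightarrow> x \<in> carrier K"
  using submodD(1)[OF m_submod] .

lemma A_subset_S: "A \<subseteq> S"
  using submodD(4)[OF m_submod] A_closed(1) by (auto simp: S_def)

lemma S_closed: "s \<in> S \<Longrightarrow> s \<in> carrier K" "\<zero> \<in> S" "\<one> \<in> S"
  "s \<in> S \<Longrightarrow> t \<in> S \<Longrightarrow> s \<oplus> t \<in> S" "s \<in> S \<Longrightarrow> t \<in> S \<Longrightarrow> s \<otimes> t \<in> S"
proof -
  show "\<zero> \<in> S" "\<one> \<in> S" using A_subset_S A_closed by auto
  show "s \<in> S \<Longrightarrow> s \<in> carrier K" by (simp add: S_def)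
  show "s \<in> S \<Longrightarrow> t \<in> S \<Longrightarrow> s \<oplus> t \<in> S"
    using submodD(3)[OF m_submod] m_closed' by (auto simp: S_def l_distr)
  show "s \<in> S \<Longrightarrow> t \<in> S \<Longrightarrow> s \<otimes> t \<in> S"
    using m_closed' by (auto simp: S_def m_assoc)
qed

lemma S_m: "s \<in> S \<Longrightarrow> x \<in> \<mm> \<Longrightarrow> s \<otimes> x \<in> \<mm>" "s \<in> S \<Longrightarrow> x \<in> \<mm> \<Longrightarrow> x \<otimes> s \<in> \<mm>"
  using m_closed' by (auto simp: S_def m_comm)

lemma m_subset_S: "\<mm> \<subseteq> S"
  using m_subset A_subset_S by blast

text \<open>A nonzero x in \<mm> satisfies x S \<subseteq> \<mm> \<subseteq> A, so x is a common
  denominator for all ideals of \<open>S\<close>.\<close>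

lemma S_acc:
  assumes ne: "\<C> \<noteq> {}" and \<C>: "\<And>I. I \<in> \<C> \<Longrightarrow> submod K S I \<and> I \<subseteq> S"
  shows "\<exists>M\<in>\<C>. \<forall>I\<in>\<C>. M \<subseteq> I \<longrightarrow> I = M"
proof -
  obtain x where x: "x \<in> \<mm>" "x \<noteq> \<zero>" using m_nonzero by blast
  show ?thesis
  proof (rule acc_fractional[OF ne m_closed'[OF x(1)] x(2)])
    fix N assume N: "N \<in> \<C>"
    show "submod K A N" using \<C>[OF N] submod_mono A_subset_S by blast
    fix s assume "s \<in> N"
    then show "x \<otimes> s \<in> A" using \<C>[OF N] S_m(2) x m_subset by blast
  qed
qed

text \<open>Integral closedness in the form needed later: J is a fractional \<open>A\<close>-module
  stable under y, so y is integral over \<open>A\<close>, and \<open>normal\<close> places it in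
  (\<mm> : \<mm>).\<close>

lemma S_normal:
  assumes y: "y \<in> carrier K" and J: "submod K S J" "J \<subseteq> S" "\<exists>x\<in>J. x \<noteq> \<zero>"
    and yJ: "\<And>x. x \<in> J \<Longrightarrow> y \<otimes> x \<in> J"
  shows "y \<in> S"
proof -
  obtain c where c: "c \<in> \<mm>" "c \<noteq> \<zero>" using m_nonzero by blast
  obtain x where x: "x \<in> J" "x \<noteq> \<zero>" using J by blast
  have "\<zero> \<in> monic_values K A y"
  proof (rule zero_monic_value[OF y submod_mono[OF J(1) A_subset_S] m_closed'[OF c(1)] c(2) _ x yJ])
    show "z \<in> J \<Longrightarrow> c \<otimes> z \<in> A" for z using J S_m(2) c m_subset by blast
  qed
  then show ?thesis using normal[OF y] y by (simp add: S_def)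
qed

section \<open>Nonzero primes of S\<close>

text \<open>The zero ideal is excluded because maximality and the inclusion of \<mm> hold for
  nonzero primes.\<close>

definition S_prime where
  "S_prime P \<longleftrightarrow> submod K S P \<and> P \<subseteq> S \<and> (\<exists>x\<in>P. x \<noteq> \<zero>) \<and> \<one> \<notin> P \<and>
     (\<forall>s\<in>S. \<forall>t\<in>S. s \<otimes> t \<in> P \<longrightarrow> s \<in> P \<or> t \<in> P)"

lemma S_primeD:
  assumes "S_prime P"
  shows "submod K S P" "P \<subseteq> S" "\<exists>x\<in>P. x \<noteq> \<zero>" "\<one> \<notin> P"
    "s \<in> S \<Longrightarrow> t \<in> S \<Longrightarrow> s \<otimes> t \<in> P \<Longrightarrow> s \<in> P \<or> t \<in> P"
  using assms by (auto simp: S_prime_def)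

lemma nonzero_Int_A:
  assumes I: "submod K S I" "\<exists>x\<in>I. x \<noteq> \<zero>"
  shows "\<exists>x\<in>I \<inter> A. x \<noteq> \<zero>"
proof -
  obtain x where x: "x \<in> I" "x \<noteq> \<zero>" using I by blast
  have xK: "x \<in> carrier K" using submodD(1)[OF I(1) x(1)] .
  obtain b where b: "b \<in> A" "b \<noteq> \<zero>" "b \<otimes> x \<in> A" using denominator[OF xK] by blast
  have "b \<otimes> x \<in> I" using submodD(4)[OF I(1) _ x(1)] b A_subset_S by blast
  moreover have "b \<otimes> x \<noteq> \<zero>" using b x xK A_closed(1) by (auto simp: integral_iff)
  ultimately show ?thesis using b by blast
qed

text \<open>Clearing the denominator of a nonzero element shows that the contraction to
  \<open>A\<close> is nonzero, and dimension one leaves only \<mm>. In particular every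
  \<open>S_prime\<close> contains \<mm>.\<close>

lemma S_prime_Int_A: assumes P: "S_prime P" shows "P \<inter> A = \<mm>"
proof (rule dim)
  show "submod K A (P \<inter> A)"
    by (rule submodI) (use submodD[OF submod_mono[OF S_primeD(1)[OF P] A_subset_S]] A_closed in auto)
  show "\<exists>x\<in>P \<inter> A. x \<noteq> \<zero>" using nonzero_Int_A S_primeD[OF P] by blast
  show "a \<in> A \<Longrightarrow> b \<in> A \<Longrightarrow> a \<otimes> b \<in> P \<inter> A \<Longrightarrow> a \<in> P \<inter> A \<or> b \<in> P \<inter> A" for a b
    using S_primeD(5)[OF P] A_subset_S by blast
qed (use S_primeD(4)[OF P] in auto)

text \<open>Incomparability for the integral extension of \<open>A\<close> by \<open>S\<close>. For
  s in P - Q, no monic value w at s lies in Q, by induction: if s w + r is in Q \<subseteq> P, then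
  r is in P \<inter> A = \<mm> \<subseteq> Q, so s w is in Q, against primality. But zero is a monic
  value at s.\<close>

lemma S_prime_maximal:
  assumes Q: "S_prime Q" and P: "S_prime P" and QP: "Q \<subseteq> P"
  shows "Q = P"
proof (rule ccontr)
  assume "Q \<noteq> P"
  then obtain s where s: "s \<in> P" "s \<notin> Q" using QP by blast
  have sS: "s \<in> S" using s S_primeD(2)[OF P] by blast
  have mQ: "\<mm> \<subseteq> Q" "P \<inter> A = \<mm>" using S_prime_Int_A[OF Q] S_prime_Int_A[OF P] by auto
  have "w \<in> S \<and> w \<notin> Q" if "w \<in> monic_values K A s" for w
    using that
  proof induct
    case one then show ?case using S_primeD(4)[OF Q] S_closed by blast
  next
    case (step w r)
    have rS: "r \<in> S" using step A_subset_S by blast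
    have K: "s \<in> carrier K" "w \<in> carrier K" "r \<in> carrier K" using sS step rS S_closed(1) by auto
    have sw: "s \<otimes> w \<in> S" using sS step S_closed by blast
    have "s \<otimes> w \<oplus> r \<notin> Q"
    proof
      assume *: "s \<otimes> w \<oplus> r \<in> Q"
      have "w \<otimes> s \<in> P" using submodD(4)[OF S_primeD(1)[OF P] _ s(1)] step by blast
      then have "\<ominus> (s \<otimes> w) \<in> P"
        using submod_minus[OF submod_mono[OF S_primeD(1)[OF P] A_subset_S]] K by (simp add: m_comm)
      then have "\<ominus> (s \<otimes> w) \<oplus> (s \<otimes> w \<oplus> r) \<in> P" using submodD(3)[OF S_primeD(1)[OF P]] * QP by blast
      then have "r \<in> P" using K by (simp add: a_assoc[symmetric] l_neg)
      then have "r \<in> Q" using mQ step by blast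
      then have "\<ominus> r \<in> Q" using submod_minus[OF submod_mono[OF S_primeD(1)[OF Q] A_subset_S]] by blast
      then have "s \<otimes> w \<oplus> r \<oplus> \<ominus> r \<in> Q" using submodD(3)[OF S_primeD(1)[OF Q] *] by blast
      then have "s \<otimes> w \<in> Q" using K by (simp add: a_assoc r_neg)
      then show False using S_primeD(5)[OF Q sS] step s by blast
    qed
    then show ?case using sw rS S_closed by blast
  qed
  \<comment> \<open>Integrality of s comes from s \<mm> \<subseteq> \<mm>; since \<mm> already lies
    in \<open>A\<close>, the denominator is 1.\<close>
  moreover have "\<zero> \<in> monic_values K A s"
  proof -
    obtain x where x: "x \<in> \<mm>" "x \<noteq> \<zero>" using m_nonzero by blast
    show ?thesis
      by (rule zero_monic_value[of s \<mm> \<one> x])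
        (use sS S_closed m_submod m_subset x m_closed' S_m in auto)
  qed
  ultimately show False using submodD(2)[OF S_primeD(1)[OF Q]] by blast
qed

section \<open>Primes as conductors\<close>

text \<open>This is the annihilator of the class of y in K/S, so a prime conductor is an associated
  prime of K/S.\<close>

definition conductor where "conductor y = {s \<in> S. s \<otimes> y \<in> S}"

lemma conductor_submod: "y \<in> carrier K \<Longrightarrow> submod K S (conductor y)"
  by (intro submodI) (auto simp: conductor_def S_closed l_distr m_assoc)

lemma conductor_nonzero:
  assumes y: "y \<in> carrier K" shows "\<exists>x\<in>conductor y. x \<noteq> \<zero>"
  using denominator[OF y] A_subset_S by (auto simp: conductor_def)

lemma conductor_mult:
  assumes "y \<in> carrier K" "s \<in> S" shows "conductor y \<subseteq> conductor (s \<otimes> y)"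
proof
  fix t assume t: "t \<in> conductor y"
  have "t \<otimes> (s \<otimes> y) = s \<otimes> (t \<otimes> y)" using assms t S_closed(1) by (simp add: conductor_def m_ac)
  then show "t \<in> conductor (s \<otimes> y)" using t assms S_closed(5) by (simp add: conductor_def)
qed

text \<open>Among the conductors contained in \<open>P\<close> a maximal one is prime, by the usual associated-prime
  argument; being nonzero, it equals \<open>P\<close>.\<close>
lemma S_prime_conductor:
  assumes P: "S_prime P" shows "\<exists>y\<in>carrier K. conductor y = P"
proof -
  let ?\<C> = "conductor ` {y \<in> carrier K. conductor y \<subseteq> P}"
  obtain a where a: "a \<in> P" "a \<noteq> \<zero>" using S_primeD(3)[OF P] by blast
  have aK: "a \<in> carrier K" "inv a \<in> carrier K" "a \<otimes> inv a = \<one>"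
    using submodD(1)[OF S_primeD(1)[OF P] a(1)] a by (auto simp: field_Units)
  \<comment> \<open>The conductor of 1/a is the principal ideal a S, which lies in P; this makes the
    family nonempty.\<close>
  have "conductor (inv a) \<subseteq> P"
  proof
    fix s assume s: "s \<in> conductor (inv a)"
    then have sK: "s \<in> carrier K" using S_closed(1) by (simp add: conductor_def)
    have "(s \<otimes> inv a) \<otimes> a = s \<otimes> (a \<otimes> inv a)" using aK(1,2) sK by (simp add: m_ac)
    then have "s = (s \<otimes> inv a) \<otimes> a" using aK sK by simp
    moreover have "(s \<otimes> inv a) \<otimes> a \<in> P"
      using submodD(4)[OF S_primeD(1)[OF P] _ a(1)] s by (auto simp: conductor_def)
    ultimately show "s \<in> P" by simp
  qed
  then have ne: "?\<C> \<noteq> {}" using aK by blast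
  have "\<exists>M\<in>?\<C>. \<forall>I\<in>?\<C>. M \<subseteq> I \<longrightarrow> I = M"
    by (rule S_acc[OF ne]) (use conductor_submod in \<open>auto simp: conductor_def\<close>)
  then obtain y where y: "y \<in> carrier K" "conductor y \<subseteq> P"
    and max: "\<And>z. z \<in> carrier K \<Longrightarrow> conductor z \<subseteq> P \<Longrightarrow> conductor y \<subseteq> conductor z \<Longrightarrow> conductor z = conductor y"
    by auto
  have "S_prime (conductor y)"
    unfolding S_prime_def
  proof (intro conjI ballI impI)
    show "submod K S (conductor y)" "\<exists>x\<in>conductor y. x \<noteq> \<zero>"
      using y conductor_submod conductor_nonzero by auto
    show "conductor y \<subseteq> S" by (auto simp: conductor_def)
    show "\<one> \<notin> conductor y" using y S_primeD(4)[OF P] by blast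
    fix s t assume st: "s \<in> S" "t \<in> S" "s \<otimes> t \<in> conductor y"
    have stK: "s \<in> carrier K" "t \<in> carrier K" using st S_closed by auto
    show "s \<in> conductor y \<or> t \<in> conductor y"
    \<comment> \<open>If the conductor of s y stays in P, maximality identifies it with that of y,
      and t belongs to it. Otherwise some u outside P has u s y in S; the conductor of u y stays in
      P because u is not in P, so by maximality it is that of y, and s belongs to it.\<close>
    proof (cases "conductor (s \<otimes> y) \<subseteq> P")
      case True
      have "conductor (s \<otimes> y) = conductor y"
        using max[OF _ True] conductor_mult[OF y(1) st(1)] stK y by simp
      moreover have "t \<otimes> (s \<otimes> y) = s \<otimes> t \<otimes> y" using stK y by (simp add: m_ac)
      then have "t \<in> conductor (s \<otimes> y)" using st by (simp add: conductor_def)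
      ultimately show ?thesis by simp
    next
      case False
      then obtain u where u: "u \<in> S" "u \<notin> P" "u \<otimes> (s \<otimes> y) \<in> S" by (auto simp: conductor_def)
      have uK: "u \<in> carrier K" using u S_closed by auto
      have "conductor (u \<otimes> y) \<subseteq> P"
      proof
        fix r assume r: "r \<in> conductor (u \<otimes> y)"
        then have "r \<otimes> u \<otimes> y \<in> S" using uK y S_closed(1) by (simp add: conductor_def m_assoc)
        then have "r \<otimes> u \<in> P" using r u y S_closed(5) by (auto simp: conductor_def)
        then show "r \<in> P" using S_primeD(5)[OF P] r u by (auto simp: conductor_def)
      qed
      then have "conductor (u \<otimes> y) = conductor y"
        using max conductor_mult[OF y(1) u(1)] uK y by simp
      moreover have "s \<otimes> (u \<otimes> y) = u \<otimes> (s \<otimes> y)" using stK uK y by (simp add: m_ac)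
      then have "s \<in> conductor (u \<otimes> y)" using st u by (simp add: conductor_def)
      ultimately show ?thesis by simp
    qed
  qed
  then have "conductor y = P" using S_prime_maximal[OF _ P y(2)] by blast
  with y show ?thesis by blast
qed

section \<open>Invertibility of m over S and finiteness of the set of primes\<close>

text \<open>Local invertibility of \<open>\<mm>\<close>: multiply \<open>\<mm>\<close> by powers of an element \<open>y\<close> with conductor \<open>P\<close> as
  long as the result stays in \<open>S\<close>. Integral closedness forces this to stop, and the last
  power works.\<close>
lemma locally_invertible:
  assumes P: "S_prime P"
  shows "\<exists>b\<in>carrier K. (\<forall>x\<in>\<mm>. b \<otimes> x \<in> S) \<and> (\<exists>x\<in>\<mm>. b \<otimes> x \<notin> P)"
proof -
  obtain y where y: "y \<in> carrier K" "conductor y = P" using S_prime_conductor[OF P] by blast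
  have yS: "y \<notin> S"
  proof
    assume "y \<in> S"
    then have "\<one> \<in> conductor y" using y(1) S_closed by (simp add: conductor_def)
    then show False using S_primeD(4)[OF P] y(2) by simp
  qed
  have "\<exists>k::nat. \<not> (\<forall>x\<in>\<mm>. y [^] k \<otimes> x \<in> S)"
  proof (rule ccontr)
    assume "\<not> ?thesis"
    then have all: "\<And>k::nat. \<And>x. x \<in> \<mm> \<Longrightarrow> y [^] k \<otimes> x \<in> S" by blast
    \<comment> \<open>J is an ideal of \<open>S\<close> that y maps into itself, and it would
      contain \<mm>; \<open>S_normal\<close> then forces y into S.\<close>
    define J where "J = {z \<in> S. \<forall>k::nat. y [^] k \<otimes> z \<in> S}"
    have "y \<in> S"
    proof (rule S_normal[OF y(1)])
      show "submod K S J"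
      proof (rule submodI)
        show "\<And>x. x \<in> J \<Longrightarrow> x \<in> carrier K" by (simp add: J_def S_closed)
        show "\<zero> \<in> J" using y S_closed by (simp add: J_def)
        show "\<And>u v. u \<in> J \<Longrightarrow> v \<in> J \<Longrightarrow> u \<oplus> v \<in> J"
          using y S_closed by (auto simp: J_def r_distr)
        fix b u assume b: "b \<in> S" "u \<in> J"
        have "y [^] k \<otimes> (b \<otimes> u) = b \<otimes> (y [^] k \<otimes> u)" for k :: nat
          using y b S_closed(1) by (simp add: J_def m_ac)
        then show "b \<otimes> u \<in> J" using b S_closed(5) by (simp add: J_def)
      qed
      show "J \<subseteq> S" by (auto simp: J_def)
      show "\<exists>x\<in>J. x \<noteq> \<zero>" using m_nonzero all m_subset_S by (auto simp: J_def)
      fix z assume z: "z \<in> J"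
      have zK: "z \<in> carrier K" using z S_closed by (simp add: J_def)
      have z': "y [^] k \<otimes> (y \<otimes> z) = y [^] Suc k \<otimes> z" for k :: nat using y zK by (simp add: m_assoc)
      have "y [^] (k::nat) \<otimes> (y \<otimes> z) \<in> S" for k unfolding z' using z unfolding J_def by blast
      moreover from this[of 0] have "y \<otimes> z \<in> S" using y zK by simp
      ultimately show "y \<otimes> z \<in> J" by (simp add: J_def)
    qed
    then show False using yS by simp
  qed
  then obtain k :: nat where k: "\<not> (\<forall>x\<in>\<mm>. y [^] k \<otimes> x \<in> S)"
    and least: "\<And>j. j < k \<Longrightarrow> \<forall>x\<in>\<mm>. y [^] j \<otimes> x \<in> S"
    using exists_least_iff[of "\<lambda>k. \<not> (\<forall>x\<in>\<mm>. y [^] k \<otimes> x \<in> S)"] by blast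
  \<comment> \<open>k is positive because \<mm> \<subseteq> S, so minimality applies to its
    predecessor j.\<close>
  obtain j where j: "k = Suc j"
    using k m_subset_S m_closed' by (cases k) auto
  obtain x where x: "x \<in> \<mm>" "y [^] k \<otimes> x \<notin> S" using k by blast
  \<comment> \<open>P is the conductor of y: an element of P times y would be back in S, although
    y^(j+1) x is not.\<close>
  have "y [^] j \<otimes> x \<notin> P"
  proof
    assume "y [^] j \<otimes> x \<in> P"
    then have "(y [^] j \<otimes> x) \<otimes> y \<in> S" using y(2) by (auto simp: conductor_def)
    then show False using x m_closed' y by (simp add: j m_ac)
  qed
  then show ?thesis using least[of j] x y j by (intro bexI[of _ "y [^] j"]) auto
qed

text \<open>\<open>T F\<close> is the inverse \<open>(S : \<Inter>F)\<close>. These modules lie in \<open>(S : \<mm>)\<close>, so one of them is maximal, and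
  the corresponding \<open>F\<close> already contains every prime.\<close>
lemma finite_S_primes: "finite {P. S_prime P}"
proof -
  define T where "T F = {z \<in> carrier K. \<forall>c \<in> S \<inter> \<Inter>F. c \<otimes> z \<in> S}" for F
  let ?\<C> = "T ` {F. finite F \<and> (\<forall>P\<in>F. S_prime P)}"
  obtain x where x: "x \<in> \<mm>" "x \<noteq> \<zero>" using m_nonzero by blast
  have xK: "x \<in> carrier K" using m_closed' x by simp
  have "\<exists>M\<in>?\<C>. \<forall>I\<in>?\<C>. M \<subseteq> I \<longrightarrow> I = M"
  \<comment> \<open>Two factors x are needed: x lies in every prime of F, so it takes T F into S,
    and the second x takes S into \<mm> \<subseteq> A.\<close>
  proof (rule acc_fractional[of _ "x \<otimes> x"])
    show "x \<otimes> x \<in> carrier K" "x \<otimes> x \<noteq> \<zero>" using x xK by (auto simp: integral_iff)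
    have "finite {} \<and> (\<forall>P\<in>{}. S_prime P)" by simp
    then show "?\<C> \<noteq> {}" by blast
    fix N assume "N \<in> ?\<C>"
    then obtain F where F: "finite F" "\<And>P. P \<in> F \<Longrightarrow> S_prime P" "N = T F" by auto
    show "submod K A N"
    proof (rule submodI)
      show "\<And>x. x \<in> N \<Longrightarrow> x \<in> carrier K" by (simp add: F T_def)
      show "\<zero> \<in> N" using S_closed by (simp add: F T_def)
      show "\<And>u v. u \<in> N \<Longrightarrow> v \<in> N \<Longrightarrow> u \<oplus> v \<in> N" using S_closed by (auto simp: F T_def r_distr)
      fix b u assume b: "b \<in> A" "u \<in> N"
      have "c \<otimes> (b \<otimes> u) = b \<otimes> (c \<otimes> u)" if "c \<in> S" for c
        using that b S_closed(1) A_closed(1) by (simp add: F T_def m_ac)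
      then show "b \<otimes> u \<in> N" using b S_closed(5) A_subset_S A_closed(1) by (auto simp: F T_def)
    qed
    fix z assume z: "z \<in> N"
    have "x \<in> S \<inter> \<Inter>F" using F(2) S_prime_Int_A x m_subset_S by blast
    then have "x \<otimes> z \<in> S" using z by (simp add: F T_def)
    then have "x \<otimes> (x \<otimes> z) \<in> A" using S_m(2) x m_subset by blast
    then show "x \<otimes> x \<otimes> z \<in> A" using z xK by (simp add: F T_def m_assoc)
  qed
  then obtain F where F: "finite F" "\<And>P. P \<in> F \<Longrightarrow> S_prime P"
    and max: "\<And>G. finite G \<Longrightarrow> (\<And>P. P \<in> G \<Longrightarrow> S_prime P) \<Longrightarrow> T F \<subseteq> T G \<Longrightarrow> T G = T F"
    by auto
  have "P \<in> F" if P: "S_prime P" for P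
  proof -
    obtain y where y: "y \<in> carrier K" "conductor y = P" using S_prime_conductor[OF P] by blast
    \<comment> \<open>T grows with F, so maximality gives equality. Hence y, which P multiplies into
      S, already lies in T F, and every element of the intersection of F falls into the conductor P
      of y.\<close>
    have "T (insert P F) = T F" by (rule max) (use F P in \<open>auto simp: T_def\<close>)
    moreover have "y \<in> T (insert P F)" using y by (auto simp: T_def conductor_def)
    ultimately have FP: "S \<inter> \<Inter>F \<subseteq> P" using y by (auto simp: T_def conductor_def)
    \<comment> \<open>A prime containing a finite intersection of ideals contains one of them. The
      factor S gives the empty intersection its intended value.\<close>
    have "\<exists>Q\<in>G. Q \<subseteq> P" if "finite G" "\<forall>Q\<in>G. S_prime Q" "S \<inter> \<Inter>G \<subseteq> P" for G
      using that
    proof (induct G)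
      case empty then show ?case using S_closed(3) S_primeD(4)[OF P] by auto
    next
      case (insert Q G)
      show ?case
      proof (cases "Q \<subseteq> P")
        case False
        then obtain q where q: "q \<in> Q" "q \<notin> P" by blast
        have qS: "q \<in> S" using q insert(4) S_primeD(2) by blast
        have "S \<inter> \<Inter>G \<subseteq> P"
        proof
          fix c assume c: "c \<in> S \<inter> \<Inter>G"
          have "c \<otimes> q \<in> Q" using submodD(4)[OF S_primeD(1)] insert(4) c q by blast
          moreover have "c \<otimes> q \<in> R" if "R \<in> G" for R
          proof -
            have "q \<otimes> c \<in> R" using submodD(4)[OF S_primeD(1)] insert(4) c qS that by blast
            then show ?thesis using c qS S_closed(1) by (simp add: m_comm)
          qed
          ultimately have "c \<otimes> q \<in> P" using insert(5) c qS S_closed(5) by blast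
          then show "c \<in> P" using S_primeD(5)[OF P] c q qS by blast
        qed
        then show ?thesis using insert by blast
      qed blast
    qed
    from this[OF F(1) _ FP] obtain Q where "Q \<in> F" "Q \<subseteq> P" using F by blast
    then show ?thesis using S_prime_maximal[OF F(2) P] by blast
  qed
  then have "{P. S_prime P} \<subseteq> F" by blast
  then show ?thesis using F(1) finite_subset by blast
qed

text \<open>Gluing as in the Chinese remainder theorem. If b fails at the new prime P, take d that
  works at P and c in all old primes but not in P, and use b + c d. At P the summand c d x decides,
  since b x is in P; at an old Q the summand b x decides, since c d x is in Q.\<close>

lemma semilocally_invertible:
  assumes "finite F" "\<And>P. P \<in> F \<Longrightarrow> S_prime P"
  shows "\<exists>b\<in>carrier K. (\<forall>x\<in>\<mm>. b \<otimes> x \<in> S) \<and> (\<forall>P\<in>F. \<exists>x\<in>\<mm>. b \<otimes> x \<notin> P)"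
  using assms
proof (induct F)
  case empty
  have "\<one> \<otimes> x \<in> S" if "x \<in> \<mm>" for x using that m_closed' m_subset_S by auto
  then show ?case by blast
next
  case (insert P F)
  obtain b where b: "b \<in> carrier K" "\<And>x. x \<in> \<mm> \<Longrightarrow> b \<otimes> x \<in> S" "\<And>Q. Q \<in> F \<Longrightarrow> \<exists>x\<in>\<mm>. b \<otimes> x \<notin> Q"
    using insert(3)[OF insert(4)] by auto
  have P: "S_prime P" using insert(4) by blast
  show ?case
  proof (cases "\<exists>x\<in>\<mm>. b \<otimes> x \<notin> P")
    case True then show ?thesis using b by blast
  next
    case bP: False
    obtain d where d: "d \<in> carrier K" "\<And>x. x \<in> \<mm> \<Longrightarrow> d \<otimes> x \<in> S" "\<exists>x\<in>\<mm>. d \<otimes> x \<notin> P"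
      using locally_invertible[OF P] by blast
    \<comment> \<open>c is a product of elements q in Q - P, one for each old prime Q; they exist by
      incomparability.\<close>
    have "\<exists>c\<in>S. c \<notin> P \<and> (\<forall>Q\<in>G. c \<in> Q)" if "finite G" "G \<subseteq> F" for G
      using that
    proof (induct G)
      case empty then show ?case using S_closed S_primeD(4)[OF P] by blast
    next
      case (insert Q G)
      then obtain c where c: "c \<in> S" "c \<notin> P" "\<And>Q. Q \<in> G \<Longrightarrow> c \<in> Q" by blast
      have Q: "S_prime Q" "Q \<noteq> P" using insert(4) \<open>\<And>P'. P' \<in> insert P F \<Longrightarrow> S_prime P'\<close> \<open>P \<notin> F\<close> by blast+
      then obtain q where q: "q \<in> Q" "q \<notin> P" using S_prime_maximal[OF Q(1) P] by blast
      have qS: "q \<in> S" using q S_primeD(2)[OF Q(1)] by blast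
      have "q \<otimes> c \<notin> P" using S_primeD(5)[OF P qS c(1)] q c by blast
      moreover have "q \<otimes> c \<in> R" if "R \<in> G" for R
        using that c(3) qS submodD(4)[OF S_primeD(1)] insert(4)
          \<open>\<And>P'. P' \<in> insert P F \<Longrightarrow> S_prime P'\<close> by blast
      moreover have "q \<otimes> c \<in> Q"
        using submodD(4)[OF S_primeD(1)[OF Q(1)] c(1) q(1)] qS c(1) S_closed(1) by (simp add: m_comm)
      ultimately show ?case using S_closed(5)[OF qS c(1)] by blast
    qed
    from this[OF insert(1)] obtain c where c: "c \<in> S" "c \<notin> P" "\<And>Q. Q \<in> F \<Longrightarrow> c \<in> Q" by blast
    have cK: "c \<in> carrier K" using c S_closed by simp
    define e where "e = b \<oplus> c \<otimes> d"
    have eK: "e \<in> carrier K" using b d cK by (simp add: e_def)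
    have ex: "e \<otimes> x = b \<otimes> x \<oplus> c \<otimes> (d \<otimes> x)" if "x \<in> \<mm>" for x
      using that m_closed' b d cK by (simp add: e_def l_distr m_assoc)
    have sum: "u \<in> Q \<longleftrightarrow> v \<in> Q" if "S_prime Q" "u \<oplus> v \<in> Q" "u \<in> carrier K" "v \<in> carrier K" for u v Q
    proof -
      note sub = submod_mono[OF S_primeD(1)[OF that(1)] A_subset_S]
      have "v = \<ominus> u \<oplus> (u \<oplus> v)" "u = (u \<oplus> v) \<oplus> \<ominus> v" using that
        by (simp_all add: a_assoc[symmetric] l_neg) (simp add: a_assoc r_neg)
      then show ?thesis using submodD(3)[OF sub] submod_minus[OF sub] that by metis
    qed
    have "\<exists>x\<in>\<mm>. e \<otimes> x \<notin> Q" if Q: "Q \<in> insert P F" for Q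
    proof (cases "Q = P")
      case True
      obtain x where x: "x \<in> \<mm>" "d \<otimes> x \<notin> P" using d by blast
      have "c \<otimes> (d \<otimes> x) \<notin> P" using S_primeD(5)[OF P c(1) d(2)[OF x(1)]] c x by blast
      moreover have "b \<otimes> x \<in> P" using bP x by blast
      ultimately have "e \<otimes> x \<notin> P"
        using sum[OF P, of "b \<otimes> x" "c \<otimes> (d \<otimes> x)"] b d cK x m_closed' by (auto simp: ex)
      then show ?thesis using True x by blast
    next
      case False
      then have QF: "Q \<in> F" using Q by blast
      have Qp: "S_prime Q" using Q insert by blast
      obtain x where x: "x \<in> \<mm>" "b \<otimes> x \<notin> Q" using b QF by blast
      have "(d \<otimes> x) \<otimes> c \<in> Q" using submodD(4)[OF S_primeD(1)[OF Qp] d(2)[OF x(1)] c(3)[OF QF]] .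
      then have "c \<otimes> (d \<otimes> x) \<in> Q" using d cK x m_closed' by (simp add: m_comm)
      then have "e \<otimes> x \<notin> Q"
        using sum[OF Qp, of "b \<otimes> x" "c \<otimes> (d \<otimes> x)"] b d cK x m_closed' by (auto simp: ex)
      then show ?thesis using x by blast
    qed
    moreover have "e \<otimes> x \<in> S" if "x \<in> \<mm>" for x
      using that b c d S_closed by (simp add: ex)
    ultimately show ?thesis using eK by blast
  qed
qed

section \<open>Principality of m over S, and comparison with the dual\<close>

lemma S_prime_exists:
  assumes I: "submod K S I" "I \<subseteq> S" "\<exists>x\<in>I. x \<noteq> \<zero>" "\<one> \<notin> I"
  shows "\<exists>P. S_prime P \<and> I \<subseteq> P"
proof -
  let ?\<C> = "{J. submod K S J \<and> J \<subseteq> S \<and> I \<subseteq> J \<and> \<one> \<notin> J}"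
  have ne: "I \<in> ?\<C>" using I by simp
  have "\<exists>M\<in>?\<C>. \<forall>J\<in>?\<C>. M \<subseteq> J \<longrightarrow> J = M"
    by (rule S_acc) (use ne in auto)
  then obtain M where M: "submod K S M" "M \<subseteq> S" "I \<subseteq> M" "\<one> \<notin> M"
    and max: "\<And>J. submod K S J \<Longrightarrow> J \<subseteq> S \<Longrightarrow> \<one> \<notin> J \<Longrightarrow> M \<subseteq> J \<Longrightarrow> J = M"
    by (elim bexE) (simp, blast)
  have "t \<in> M" if st: "s \<in> S" "t \<in> S" "s \<otimes> t \<in> M" "s \<notin> M" for s t
  proof -
    \<comment> \<open>J = M + S s is strictly larger than M, so it contains 1 = u + r s. Multiplying
      by t gives t = t u + r (s t), which is in M.\<close>
    let ?J = "{u \<oplus> r \<otimes> s | u r. u \<in> M \<and> r \<in> S}"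
    note sK = S_closed(1)[OF st(1)] and tK = S_closed(1)[OF st(2)]
    have J: "submod K S ?J"
    proof (rule submodI)
      have "\<zero> = \<zero> \<oplus> \<zero> \<otimes> s" using sK by simp
      then show "\<zero> \<in> ?J" using submodD(2)[OF M(1)] S_closed(2) by blast
      fix z assume "z \<in> ?J"
      then obtain u r where u: "u \<in> M" "r \<in> S" "z = u \<oplus> r \<otimes> s" by blast
      have uK: "u \<in> carrier K" "r \<in> carrier K" using u submodD(1)[OF M(1)] S_closed(1) by auto
      show "z \<in> carrier K" using u uK sK by simp
      { fix z' assume "z' \<in> ?J"
        then obtain v q where v: "v \<in> M" "q \<in> S" "z' = v \<oplus> q \<otimes> s" by blast
        have vK: "v \<in> carrier K" "q \<in> carrier K" using v submodD(1)[OF M(1)] S_closed(1) by auto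
        have "z \<oplus> z' = (u \<oplus> v) \<oplus> (r \<oplus> q) \<otimes> s" using u v uK vK sK by (simp add: l_distr a_ac)
        then show "z \<oplus> z' \<in> ?J" using submodD(3)[OF M(1) u(1) v(1)] S_closed(4)[OF u(2) v(2)] by blast }
      { fix b assume b: "b \<in> S"
        have "b \<otimes> z = b \<otimes> u \<oplus> (b \<otimes> r) \<otimes> s" using u uK sK S_closed(1)[OF b] by (simp add: r_distr m_assoc)
        then show "b \<otimes> z \<in> ?J" using submodD(4)[OF M(1) b u(1)] S_closed(5)[OF b u(2)] by blast }
    qed
    have JS: "?J \<subseteq> S" using M(2) S_closed(4,5) st by blast
    have MJ: "M \<subseteq> ?J"
    proof
      fix u assume u: "u \<in> M"
      have "u = u \<oplus> \<zero> \<otimes> s" using submodD(1)[OF M(1) u] sK by simp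
      then show "u \<in> ?J" using u S_closed(2) by blast
    qed
    have "s = \<zero> \<oplus> \<one> \<otimes> s" using sK by simp
    then have "s \<in> ?J" using submodD(2)[OF M(1)] S_closed(3) by blast
    then have "\<one> \<in> ?J" using max[OF J JS _ MJ] st by blast
    then obtain u r where u: "u \<in> M" "r \<in> S" "\<one> = u \<oplus> r \<otimes> s" by blast
    have uK: "u \<in> carrier K" "r \<in> carrier K" using u submodD(1)[OF M(1)] S_closed(1) by auto
    have "t = (u \<oplus> r \<otimes> s) \<otimes> t" using tK unfolding u(3)[symmetric] by simp
    also have "\<dots> = t \<otimes> u \<oplus> r \<otimes> (s \<otimes> t)"
      using uK sK tK by (simp add: l_distr m_assoc m_comm[of u t])
    finally have "t = t \<otimes> u \<oplus> r \<otimes> (s \<otimes> t)" .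
    then show ?thesis
      using submodD(3)[OF M(1) submodD(4)[OF M(1) st(2) u(1)] submodD(4)[OF M(1) u(2) st(3)]] by metis
  qed
  moreover have "\<exists>x\<in>M. x \<noteq> \<zero>" using I(3) M(3) by blast
  ultimately have "S_prime M" unfolding S_prime_def using M(1,2,4) by blast
  with M show ?thesis by blast
qed

lemma m_principal:
  "\<exists>u\<in>carrier K - {\<zero>}. \<mm> = (\<otimes>) u ` S"
proof -
  obtain b where b: "b \<in> carrier K" "\<And>x. x \<in> \<mm> \<Longrightarrow> b \<otimes> x \<in> S" "\<And>P. S_prime P \<Longrightarrow> \<exists>x\<in>\<mm>. b \<otimes> x \<notin> P"
    using semilocally_invertible[OF finite_S_primes] by auto
  let ?I = "(\<otimes>) b ` \<mm>"
  obtain x where x: "x \<in> \<mm>" "x \<noteq> \<zero>" using m_nonzero by blast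
  have one: "\<one> \<in> ?I" if "b \<noteq> \<zero>"
  proof (rule ccontr)
    assume n: "\<one> \<notin> ?I"
    have "submod K S ?I"
    proof (rule submodI)
      show "\<And>z. z \<in> ?I \<Longrightarrow> z \<in> carrier K" using b m_closed' by auto
      show "\<zero> \<in> ?I" using submodD(2)[OF m_submod] b by (intro image_eqI[of _ _ \<zero>]) auto
      fix z assume "z \<in> ?I"
      then obtain u where u: "u \<in> \<mm>" "z = b \<otimes> u" by auto
      { fix z' assume "z' \<in> ?I"
        then obtain v where v: "v \<in> \<mm>" "z' = b \<otimes> v" by auto
        have "z \<oplus> z' = b \<otimes> (u \<oplus> v)" using u v b m_closed' by (simp add: r_distr)
        then show "z \<oplus> z' \<in> ?I" using submodD(3)[OF m_submod] u v by auto }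
      { fix s assume s: "s \<in> S"
        have "s \<otimes> z = b \<otimes> (s \<otimes> u)" using u b m_closed' S_closed(1)[OF s] by (simp add: m_ac)
        then show "s \<otimes> z \<in> ?I" using S_m s u by auto }
    qed
    moreover have "\<exists>x\<in>?I. x \<noteq> \<zero>" using x b that m_closed' by (auto simp: integral_iff)
    ultimately obtain P where "S_prime P" "?I \<subseteq> P" using S_prime_exists[of ?I] n b by blast
    then show False using b(3) by blast
  qed
  \<comment> \<open>If \<open>S\<close> had no nonzero prime, the condition on b would be vacuous.
    But \<mm> is itself a proper nonzero ideal of \<open>S\<close>, so some prime exists, and it
    excludes b = 0.\<close>
  have b0: "b \<noteq> \<zero>"
  proof
    assume "b = \<zero>"
    have "submod K S \<mm>" by (rule submodI) (use submodD[OF m_submod] S_m in auto)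
    then obtain P where "S_prime P" using S_prime_exists m_subset_S m_nonzero m_proper by blast
    then show False using b(3) submodD(2)[OF S_primeD(1)] \<open>b = \<zero>\<close> m_closed' by auto
  qed
  obtain x where x: "x \<in> \<mm>" "b \<otimes> x = \<one>" using one[OF b0] by auto
  note xK = m_closed'[OF x(1)]
  have "\<mm> = (\<otimes>) x ` S"
  proof
    show "(\<otimes>) x ` S \<subseteq> \<mm>" using S_m x by auto
    show "\<mm> \<subseteq> (\<otimes>) x ` S"
    proof
      fix z assume z: "z \<in> \<mm>"
      have "x \<otimes> (b \<otimes> z) = (b \<otimes> x) \<otimes> z" using b xK m_closed'[OF z] by (simp add: m_ac)
      then have "z = x \<otimes> (b \<otimes> z)" using x m_closed'[OF z] by simp
      then show "z \<in> (\<otimes>) x ` S" using b(2)[OF z] by blast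
    qed
  qed
  moreover have "x \<noteq> \<zero>" using x b(1) one_not_zero by auto
  ultimately show ?thesis using xK by blast
qed

text \<open>If some \<open>y \<in> (A : \<mm>)\<close> does not map \<open>\<mm>\<close> into itself, then \<open>y w\<close> is a unit of \<open>A\<close> for some \<open>w \<in> \<mm>\<close>,
  so \<open>\<mm> = w A\<close> and \<open>(A : \<mm>) = w\<^sup>-\<^sup>1 A\<close>.\<close>
lemma m_eq_dual:
  "\<exists>u\<in>carrier K - {\<zero>}. \<mm> = (\<otimes>) u ` {y \<in> carrier K. \<forall>x\<in>\<mm>. y \<otimes> x \<in> A}"
    (is "\<exists>u\<in>_. \<mm> = (\<otimes>) u ` ?D")
proof (cases "?D \<subseteq> S")
  case True
  then have "?D = S" using m_subset by (auto simp: S_def)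
  then show ?thesis using m_principal by simp
next
  case False
  then obtain y w where y: "y \<in> carrier K" "\<And>x. x \<in> \<mm> \<Longrightarrow> y \<otimes> x \<in> A" and w: "w \<in> \<mm>" "y \<otimes> w \<notin> \<mm>"
    by (auto simp: S_def)
  note wK = m_closed'[OF w(1)]
  obtain c where c: "c \<in> A" "c \<otimes> (y \<otimes> w) = \<one>" using units[OF y(2)[OF w(1)] w(2)] by blast
  note cK = A_closed(1)[OF c(1)]
  have w0: "w \<noteq> \<zero>" using c y(1) cK one_not_zero by auto
  have m: "\<exists>a\<in>A. z = a \<otimes> w" if z: "z \<in> \<mm>" for z
  proof
    have "(c \<otimes> (y \<otimes> z)) \<otimes> w = (c \<otimes> (y \<otimes> w)) \<otimes> z"
      using cK y wK m_closed'[OF z] by (simp add: m_ac)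
    then show "z = (c \<otimes> (y \<otimes> z)) \<otimes> w" using c m_closed'[OF z] by simp
    show "c \<otimes> (y \<otimes> z) \<in> A" using c y(2)[OF z] A_closed by simp
  qed
  have wi: "inv w \<in> carrier K" "inv w \<otimes> w = \<one>" using wK w0 by (auto simp: field_Units)
  \<comment> \<open>The factor is a square because \<mm> = w A while the dual is w^(-1) A.\<close>
  have "\<mm> = (\<otimes>) (w \<otimes> w) ` ?D"
  proof
    show "(\<otimes>) (w \<otimes> w) ` ?D \<subseteq> \<mm>"
    proof
      fix z assume "z \<in> (\<otimes>) (w \<otimes> w) ` ?D"
      then obtain d where d: "d \<in> carrier K" "d \<otimes> w \<in> A" "z = (w \<otimes> w) \<otimes> d" using w by auto
      have "z = (d \<otimes> w) \<otimes> w" using d wK by (simp add: m_ac)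
      then show "z \<in> \<mm>" using submodD(4)[OF m_submod d(2) w(1)] by simp
    qed
    show "\<mm> \<subseteq> (\<otimes>) (w \<otimes> w) ` ?D"
    proof
      fix z assume z: "z \<in> \<mm>"
      obtain a where a: "a \<in> A" "z = a \<otimes> w" using m[OF z] by blast
      note aK = A_closed(1)[OF a(1)]
      have "(inv w \<otimes> a) \<otimes> x \<in> A" if x: "x \<in> \<mm>" for x
      proof -
        obtain a' where a': "a' \<in> A" "x = a' \<otimes> w" using m[OF x] by blast
        have "(inv w \<otimes> a) \<otimes> x = (inv w \<otimes> w) \<otimes> (a \<otimes> a')"
          using a' A_closed(1)[OF a'(1)] aK wK wi(1) by (simp add: m_ac)
        then show ?thesis using wi a a' A_closed by simp
      qed
      then have "inv w \<otimes> a \<in> ?D" using wi aK by simp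
      moreover have "(w \<otimes> w) \<otimes> (inv w \<otimes> a) = (inv w \<otimes> w) \<otimes> (a \<otimes> w)"
        using aK wK wi(1) by (simp add: m_ac)
      then have "z = (w \<otimes> w) \<otimes> (inv w \<otimes> a)" using a aK wi wK by simp
      ultimately show "z \<in> (\<otimes>) (w \<otimes> w) ` ?D" by blast
    qed
  qed
  moreover have "w \<otimes> w \<in> carrier K - {\<zero>}" using wK w0 by (auto simp: integral_iff)
  ultimately show ?thesis by blast
qed

end

section \<open>Noetherian rings and Krull dimension one\<close>

lemma (in cring) submod_imp_ideal:
  assumes "submod R (carrier R) I" shows "ideal I R"
proof (rule idealI[OF ring_axioms])
  note I = submodD[OF assms]
  show "subgroup I (add_monoid R)"
  proof (rule add.subgroupI)
    fix a assume a: "a \<in> I"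
    have "(\<ominus> \<one>) \<otimes> a \<in> I" using I(4) a by simp
    then show "\<ominus> a \<in> I" using I(1)[OF a] by (simp add: l_minus)
  qed (use I in auto)
  show "a \<in> I \<Longrightarrow> x \<in> carrier R \<Longrightarrow> x \<otimes> a \<in> I" for a x using I by blast
  then show "a \<in> I \<Longrightarrow> x \<in> carrier R \<Longrightarrow> a \<otimes> x \<in> I" for a x using I(1) by (simp add: m_comm)
qed

text \<open>A nonempty chain of ideals in a noetherian ring contains its own union, so Zorn's lemma
  applies to any family.\<close>

lemma (in noetherian_ring) exists_maximal_ideal_in:
  assumes "\<C> \<noteq> {}" "\<And>I. I \<in> \<C> \<Longrightarrow> ideal I R"
  shows "\<exists>M\<in>\<C>. \<forall>I\<in>\<C>. M \<subseteq> I \<longrightarrow> I = M"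
proof (rule subset_Zorn_nonempty[OF assms(1)])
  fix C assume C: "C \<noteq> {}" "subset.chain \<C> C"
  then have "C \<subseteq> \<C>" by (simp add: pred_on.chain_def)
  have "subset.chain {I. ideal I R} C"
    using C(2) assms(2) \<open>C \<subseteq> \<C>\<close> by (auto simp: pred_on.chain_def)
  from ideal_chain_is_trivial[OF C(1) this] show "\<Union>C \<in> \<C>"
    by (rule subsetD[OF \<open>C \<subseteq> \<C>\<close>])
qed

lemma (in noetherian_ring) proper_ideal_le_maximal:
  assumes "ideal I R" "I \<noteq> carrier R"
  shows "\<exists>M. maximalideal M R \<and> I \<subseteq> M"
proof -
  have "\<exists>M\<in>{J. ideal J R \<and> I \<subseteq> J \<and> J \<noteq> carrier R}.
      \<forall>J\<in>{J. ideal J R \<and> I \<subseteq> J \<and> J \<noteq> carrier R}. M \<subseteq> J \<longrightarrow> J = M"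
    by (rule exists_maximal_ideal_in) (use assms in auto)
  then obtain M where M: "ideal M R" "I \<subseteq> M" "M \<noteq> carrier R"
    and max: "\<And>J. ideal J R \<Longrightarrow> J \<noteq> carrier R \<Longrightarrow> M \<subseteq> J \<Longrightarrow> J = M"
    by (elim bexE) (simp, blast)
  have "maximalideal M R" by (rule maximalidealI) (use M max in auto)
  with M show ?thesis by blast
qed

text \<open>Otherwise only chains of length 0 exist and the supremum is 0. This is the source of a
  nonzero element of \<mm>.\<close>

lemma krull_dim_one_nonzero_prime:
  assumes "krull_dim R = 1"
  shows "\<exists>P Q. primeideal P R \<and> primeideal Q R \<and> P \<subset> Q"
proof (rule ccontr)
  assume no: "\<not> ?thesis"
  have "krull_dim R \<le> 0"
    unfolding krull_dim_def
  proof (rule Sup_least, clarify)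
    fix n and P :: "nat \<Rightarrow> 'a set"
    assume P: "\<forall>i\<le>n. primeideal (P i) R" "\<forall>i<n. P i \<subset> P (Suc i)"
    have "n = 0"
    proof (rule ccontr)
      assume "n \<noteq> 0"
      then have "primeideal (P 0) R" "primeideal (P (Suc 0)) R" "P 0 \<subset> P (Suc 0)"
        using P by auto
      with no show False by blast
    qed
    then show "enat n \<le> 0" by (simp add: zero_enat_def)
  qed
  with assms show False by simp
qed

lemma krull_dim_one_chain:
  assumes "krull_dim R = 1" "primeideal P R" "primeideal Q R" "primeideal M R" "P \<subset> Q" "Q \<subseteq> M"
  shows "Q = M"
proof (rule ccontr)
  assume "Q \<noteq> M"
  then have "Q \<subset> M" using assms by blast
  define C where "C i = (if i = 0 then P else if i = 1 then Q else M)" for i :: nat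
  have "\<forall>i\<le>2. primeideal (C i) R" "\<forall>i<2. C i \<subset> C (Suc i)"
    using assms \<open>Q \<subset> M\<close> by (auto simp: C_def less_Suc_eq numeral_2_eq_2)
  then have "enat 2 \<le> krull_dim R" unfolding krull_dim_def by (intro Sup_upper) blast
  with assms(1) show False by (simp add: one_enat_def)
qed

section \<open>Transfer between R and its fraction field\<close>

text \<open>Coefficient lists start with the leading coefficient, so a Horner step with r appends r
  at the end of the list.\<close>

lemma (in domain) monic_values_integral:
  assumes A: "subring A R" and y: "y \<in> carrier R" and "\<zero> \<in> monic_values R A y"
  shows "integral_over R A y"
proof -
  have "\<exists>rs. set rs \<subseteq> A \<and> eval (\<one> # rs) y = w" if "w \<in> monic_values R A y" for w
    using that
  proof induct
    case one then show ?case using y by (intro exI[of _ "[]"]) simp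
  next
    case (step w r)
    then obtain rs where rs: "set rs \<subseteq> A" "eval (\<one> # rs) y = w" by blast
    have c: "set (\<one> # rs) \<subseteq> carrier R" "r \<in> carrier R"
      using rs step subringE(1)[OF A] by auto
    have "eval (\<one> # (rs @ [r])) y = eval (\<one> # rs) y \<otimes> y \<oplus> r"
      using eval_append_aux[OF c y] by simp
    also have "\<dots> = y \<otimes> w \<oplus> r"
      using eval_in_carrier[OF c(1) y] y unfolding rs(2) by (simp add: m_comm)
    finally show ?case using rs step by (intro exI[of _ "rs @ [r]"]) simp
  qed
  then obtain rs where rs: "set rs \<subseteq> A" "eval (\<one> # rs) y = \<zero>" using assms by blast
  have "\<one> # rs \<in> carrier (univ_poly R A)"
    using rs subringE(3)[OF A] by (simp add: univ_poly_carrier[symmetric] polynomial_def)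
  then show ?thesis unfolding integral_over_def using rs by (intro bexI[of _ "\<one> # rs"]) auto
qed

text \<open>An \<open>R\<close>-algebra map into \<open>End(I)\<close> is determined on fractions: with \<open>y = a/b\<close>,
  \<open>b h(y) = h(a) = a\<close>, so \<open>h(y)\<close> is multiplication by \<open>y\<close>.\<close>
lemma (in domain) algebra_iso_End_mult:
  assumes I: "I \<subseteq> carrier R"
    and iso: "algebra_iso R (normalization R) (end_algebra R (ideal_module R I))"
    and y: "y \<in> carrier (fraction_field R)"
      "integral_over (fraction_field R) (frac_embed R ` carrier R) y"
    and one: "integral_over (fraction_field R) (frac_embed R ` carrier R) \<one>\<^bsub>fraction_field R\<^esub>"
    and x: "x \<in> I"
  shows "y \<otimes>\<^bsub>fraction_field R\<^esub> frac_embed R x \<in> frac_embed R ` I"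
proof -
  let ?N = "normalization R" and ?E = "end_algebra R (ideal_module R I)"
  obtain h where h: "h \<in> ring_iso ?N ?E"
    and lin: "\<And>r z. r \<in> carrier R \<Longrightarrow> z \<in> carrier ?N \<Longrightarrow> h (r \<odot>\<^bsub>?N\<^esub> z) = r \<odot>\<^bsub>?E\<^esub> h z"
    using iso unfolding algebra_iso_def by blast
  obtain a b where ab: "a \<in> carrier R" "b \<in> carrier R" "b \<noteq> \<zero>" "y = fraction R a b"
    using y(1) by (rule frac_cases)
  \<comment> \<open>h is controlled only on the carrier of the normalization, so 1 must be known to
    be integral; the assumption \<open>one\<close> provides this.\<close>
  have yN: "y \<in> carrier ?N" and oneN: "\<one>\<^bsub>?N\<^esub> \<in> carrier ?N"
    using y one frac_closed[of \<one> \<one>] by (auto simp: normalization_def frac_one)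
  have "b \<odot>\<^bsub>?N\<^esub> y = a \<odot>\<^bsub>?N\<^esub> \<one>\<^bsub>?N\<^esub>"
    using ab by (simp add: normalization_def frac_embed_def frac_one frac_mult frac_eq_iff m_comm)
  then have "b \<odot>\<^bsub>?E\<^esub> h y = a \<odot>\<^bsub>?E\<^esub> h \<one>\<^bsub>?N\<^esub>" using lin ab yN oneN by metis
  moreover have "h \<one>\<^bsub>?N\<^esub> = (\<lambda>x\<in>I. x)"
    using ring_iso_memE(4)[OF h] by (simp add: end_algebra_def ideal_module_def)
  ultimately have *: "b \<otimes> h y x = a \<otimes> x"
    using x by (auto simp: end_algebra_def hom_module_def ideal_module_def dest: fun_cong[of _ _ x])
  have "h y \<in> carrier ?E" using ring_iso_memE(1)[OF h yN] .
  then have hx: "h y x \<in> I"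
    using x by (auto simp: end_algebra_def hom_module_def ideal_module_def lin_maps_def)
  have K: "h y x \<in> carrier R" "x \<in> carrier R" using hx x I by auto
  have "y \<otimes>\<^bsub>fraction_field R\<^esub> frac_embed R x = frac_embed R (h y x)"
    using ab K *[symmetric] by (simp add: frac_embed_def frac_mult frac_eq_iff m_comm)
  with hx show ?thesis by blast
qed

text \<open>A linear map from I to R is multiplication by an element of K, so the dual is (R : I) in
  disguise, and division by u carries I onto it.\<close>

lemma (in domain) module_iso_dual:
  assumes I: "ideal I R" and ne: "\<exists>x\<in>I. x \<noteq> \<zero>"
    and u: "u \<in> carrier (fraction_field R)" "u \<noteq> \<zero>\<^bsub>fraction_field R\<^esub>"
    and eq: "frac_embed R ` I = (\<otimes>\<^bsub>fraction_field R\<^esub>) u ` {y \<in> carrier (fraction_field R).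
      \<forall>x\<in>frac_embed R ` I. y \<otimes>\<^bsub>fraction_field R\<^esub> x \<in> frac_embed R ` carrier R}"
  shows "module_iso R (ideal_module R I) (dual_module R (ideal_module R I))"
proof -
  define K where "K = fraction_field R"
  define e where "e = frac_embed R"
  interpret K: field K unfolding K_def by (rule field_fraction_field)
  interpret e: ring_hom_cring R K e
    by unfold_locales (use frac_embed_hom in \<open>simp add: e_def K_def\<close>)
  interpret I: ideal I R by (rule I)
  note [simp] = I.Icarr
  have inj: "e a = e b \<longleftrightarrow> a = b" if "a \<in> carrier R" "b \<in> carrier R" for a b
    using frac_embed_inj that by (auto simp: e_def inj_on_def)
  let ?D = "{y \<in> carrier K. \<forall>x\<in>I. y \<otimes>\<^bsub>K\<^esub> e x \<in> e ` carrier R}"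
  have eq': "e ` I = (\<otimes>\<^bsub>K\<^esub>) u ` ?D" using eq by (simp add: e_def K_def)
  have u': "u \<in> carrier K" "u \<noteq> \<zero>\<^bsub>K\<^esub>" using u by (auto simp: K_def)
  have "\<forall>r\<in>I. \<exists>y. y \<in> ?D \<and> e r = u \<otimes>\<^bsub>K\<^esub> y"
  proof
    fix r assume "r \<in> I"
    then have "e r \<in> (\<otimes>\<^bsub>K\<^esub>) u ` ?D" unfolding eq'[symmetric] by simp
    then show "\<exists>y. y \<in> ?D \<and> e r = u \<otimes>\<^bsub>K\<^esub> y" by blast
  qed
  from bchoice[OF this] obtain q where q: "\<forall>r\<in>I. q r \<in> ?D \<and> e r = u \<otimes>\<^bsub>K\<^esub> q r" ..
  have qK: "q r \<in> carrier K" "e r = u \<otimes>\<^bsub>K\<^esub> q r" if "r \<in> I" for r using q that by auto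
  \<comment> \<open>q r is r/u, so g r x is r x / u pulled back to R: the value at x of the
    functional attached to r.\<close>
  define g where "g r x = inv_into (carrier R) e (q r \<otimes>\<^bsub>K\<^esub> e x)" for r x
  have g: "g r x \<in> carrier R \<and> q r \<otimes>\<^bsub>K\<^esub> e x = e (g r x)" if "r \<in> I" "x \<in> I" for r x
  proof -
    have "q r \<otimes>\<^bsub>K\<^esub> e x \<in> e ` carrier R" using q that by blast
    then show ?thesis unfolding g_def by (metis f_inv_into_f inv_into_into)
  qed
  have gR [simp]: "g r x \<in> carrier R" if "r \<in> I" "x \<in> I" for r x using g that by blast
  \<comment> \<open>Since u is cancellable, g r x is determined by u z = r x in K; linearity in both
    arguments follows from this uniqueness.\<close>
  have gI: "z = g r x" if "r \<in> I" "x \<in> I" "z \<in> carrier R" "u \<otimes>\<^bsub>K\<^esub> e z = e r \<otimes>\<^bsub>K\<^esub> e x" for r x z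
  proof -
    have "u \<otimes>\<^bsub>K\<^esub> e z = u \<otimes>\<^bsub>K\<^esub> e (g r x)"
      using that qK[OF that(1)] g[OF that(1,2)] u' by (simp add: K.m_assoc)
    then have "e z = e (g r x)" using K.m_lcancel[OF u'(2,1)] that by simp
    then show ?thesis using inj[of z "g r x"] that by simp
  qed
  have ug: "u \<otimes>\<^bsub>K\<^esub> e (g r x) = e r \<otimes>\<^bsub>K\<^esub> e x" if "r \<in> I" "x \<in> I" for r x
    using K.m_assoc[OF u'(1) qK(1)[OF that(1)], of "e x"] qK(2)[OF that(1)] g[OF that] that by simp
  have add: "g r (x \<oplus> y) = g r x \<oplus> g r y" "g (x \<oplus> y) r = g x r \<oplus> g y r"
    if "r \<in> I" "x \<in> I" "y \<in> I" for r x y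
    by (rule gI[symmetric]; use that u' in \<open>simp add: ug K.r_distr K.l_distr\<close>)+
  have mult: "g r (s \<otimes> x) = s \<otimes> g r x" "g (s \<otimes> x) r = s \<otimes> g x r"
    if "r \<in> I" "x \<in> I" "s \<in> carrier R" for r s x
  proof -
    have "u \<otimes>\<^bsub>K\<^esub> e (s \<otimes> g r x) = e s \<otimes>\<^bsub>K\<^esub> (u \<otimes>\<^bsub>K\<^esub> e (g r x))"
      "u \<otimes>\<^bsub>K\<^esub> e (s \<otimes> g x r) = e s \<otimes>\<^bsub>K\<^esub> (u \<otimes>\<^bsub>K\<^esub> e (g x r))"
      using that u' by (simp_all add: K.m_ac)
    then show "g r (s \<otimes> x) = s \<otimes> g r x" "g (s \<otimes> x) r = s \<otimes> g x r"
      using that by (auto intro!: gI[symmetric] simp: ug K.m_ac I.I_l_closed)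
  qed
  obtain w where w: "w \<in> I" "w \<noteq> \<zero>" using ne by blast
  have ew: "e w \<in> carrier K" "e w \<noteq> \<zero>\<^bsub>K\<^esub>" using w inj[of w \<zero>] by auto
  define H where "H = (\<lambda>r\<in>I. \<lambda>x\<in>I. g r x)"
  let ?L = "carrier (dual_module R (ideal_module R I))"
  have L: "?L = {f \<in> I \<rightarrow>\<^sub>E carrier R. (\<forall>x\<in>I. \<forall>y\<in>I. f (x \<oplus> y) = f x \<oplus> f y) \<and>
      (\<forall>r\<in>carrier R. \<forall>x\<in>I. f (r \<otimes> x) = r \<otimes> f x)}"
    by (simp add: dual_module_def hom_module_def lin_maps_def ideal_module_def)
  have HL: "H r \<in> ?L" if "r \<in> I" for r
    using that add(1) mult(1) by (auto simp: L H_def I.I_l_closed)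
  have "H \<in> lin_maps R (ideal_module R I) (dual_module R (ideal_module R I))"
  proof -
    have "H (x \<oplus> y) = (\<lambda>z\<in>I. H x z \<oplus> H y z)" if "x \<in> I" "y \<in> I" for x y
      using that add(2) by (auto simp: H_def intro!: restrict_ext)
    moreover have "H (s \<otimes> x) = (\<lambda>z\<in>I. s \<otimes> H x z)" if "x \<in> I" "s \<in> carrier R" for s x
      using that mult(2) by (auto simp: H_def I.I_l_closed intro!: restrict_ext)
    moreover have "H \<in> I \<rightarrow>\<^sub>E ?L" using HL by (auto simp: H_def)
    ultimately show ?thesis
      by (simp add: lin_maps_def) (simp add: dual_module_def hom_module_def ideal_module_def)
  qed
  moreover have "bij_betw H I ?L"
  proof (rule bij_betwI')
    fix r s assume rs: "r \<in> I" "s \<in> I"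
    have "r = s" if "H r = H s"
    proof -
      have "g r w = g s w" using fun_cong[OF that, of w] rs w by (simp add: H_def)
      then have "e r \<otimes>\<^bsub>K\<^esub> e w = e s \<otimes>\<^bsub>K\<^esub> e w" using ug rs w by metis
      then show ?thesis using ew rs inj by (simp add: K.m_rcancel)
    qed
    then show "(H r = H s) = (r = s)" by blast
  next
    fix f assume f: "f \<in> ?L"
    have fR: "f x \<in> carrier R" if "x \<in> I" for x using f that by (auto simp: L)
    \<comment> \<open>The multiplier of f is f(w)/w, because w f(x) = f(w x) = x f(w).\<close>
    define y where "y = inv\<^bsub>K\<^esub> (e w) \<otimes>\<^bsub>K\<^esub> e (f w)"
    have iw: "inv\<^bsub>K\<^esub> (e w) \<in> carrier K" "e w \<otimes>\<^bsub>K\<^esub> inv\<^bsub>K\<^esub> (e w) = \<one>\<^bsub>K\<^esub>"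
      using ew by (auto simp: K.field_Units)
    have yf: "y \<otimes>\<^bsub>K\<^esub> e x = e (f x)" if x: "x \<in> I" for x
    proof -
      have "x \<otimes> f w = f (x \<otimes> w)" "w \<otimes> f x = f (w \<otimes> x)" using f x w by (auto simp: L)
      then have "w \<otimes> f x = x \<otimes> f w" using x w by (simp add: m_comm)
      then have "e x \<otimes>\<^bsub>K\<^esub> e (f w) = e w \<otimes>\<^bsub>K\<^esub> e (f x)" using x w fR by (metis I.Icarr e.hom_mult)
      moreover have "y \<otimes>\<^bsub>K\<^esub> e x = inv\<^bsub>K\<^esub> (e w) \<otimes>\<^bsub>K\<^esub> (e x \<otimes>\<^bsub>K\<^esub> e (f w))"
        using iw(1) x w fR by (simp add: y_def K.m_ac)
      moreover have "inv\<^bsub>K\<^esub> (e w) \<otimes>\<^bsub>K\<^esub> (e w \<otimes>\<^bsub>K\<^esub> e (f x)) = (e w \<otimes>\<^bsub>K\<^esub> inv\<^bsub>K\<^esub> (e w)) \<otimes>\<^bsub>K\<^esub> e (f x)"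
        using iw(1) ew x fR by (simp add: K.m_ac)
      ultimately show ?thesis using iw x fR by simp
    qed
    have yK: "y \<in> carrier K" using iw fR w by (simp add: y_def)
    then have "y \<in> ?D" using yf fR by auto
    then obtain r where r: "r \<in> I" "e r = u \<otimes>\<^bsub>K\<^esub> y" using eq' by (metis (no_types, lifting) image_iff)
    have "f x = g r x" if "x \<in> I" for x
      by (rule gI) (use that r fR yK u' yf in \<open>simp_all add: K.m_assoc\<close>)
    then have "f = H r" using f r by (auto simp: L H_def PiE_iff extensional_def fun_eq_iff)
    then show "\<exists>r\<in>I. f = H r" using r by blast
  qed (use HL in auto)
  ultimately show ?thesis unfolding module_iso_def by (auto simp: ideal_module_def)
qed

text \<open>The embedding is injective, so ideals of its image correspond to ideals of R by
  contraction; this carries over noetherianity, units and dimension. The assumption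
  \<open>normal\<close> is supplied by \<open>algebra_iso_End_mult\<close>.\<close>

lemma one_dim_local_fraction_field:
  fixes R (structure)
  assumes "noetherian_domain R" "local_ring R \<mm>" "krull_dim R = 1" "one_step_normal R \<mm>"
  shows "one_dim_local (fraction_field R) (frac_embed R ` carrier R) (frac_embed R ` \<mm>)"
proof -
  interpret noetherian_domain R by fact
  interpret loc: local_ring R \<mm> by fact
  define K where "K = fraction_field R"
  define e where "e = frac_embed R"
  interpret K: field K unfolding K_def by (rule field_fraction_field)
  interpret e: ring_hom_cring R K e
    by unfold_locales (use frac_embed_hom in \<open>simp add: e_def K_def\<close>)
  have inj: "e a = e b \<longleftrightarrow> a = b" if "a \<in> carrier R" "b \<in> carrier R" for a b
    using frac_embed_inj that by (auto simp: e_def inj_on_def)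
  have m_prime: "primeideal \<mm> R" by (rule maximalideal_prime) (rule loc.is_maximalideal)
  have le_m: "I \<subseteq> \<mm>" if "ideal I R" "I \<noteq> carrier R" for I
    using proper_ideal_le_maximal[OF that] loc.maximal_unique by blast
  have one_m: "\<one> \<notin> \<mm>" using loc.one_imp_carrier loc.I_notcarr by blast
  obtain w where w: "w \<in> \<mm>" "w \<noteq> \<zero>"
  proof -
    obtain P Q where PQ: "primeideal P R" "primeideal Q R" "P \<subset> Q"
      using krull_dim_one_nonzero_prime assms by blast
    have "Q \<subseteq> \<mm>" using le_m PQ(2) primeideal.I_notcarr primeideal.axioms(1) by blast
    moreover have "\<zero> \<in> P" using PQ(1) by (simp add: additive_subgroup.zero_closed ideal.axioms(1) primeideal.axioms(1))
    ultimately show ?thesis using PQ(3) that by blast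
  qed
  have A: "subring (e ` carrier R) K" using e.ring.img_is_subring[OF carrier_is_subring] .
  let ?contr = "\<lambda>N. {x \<in> carrier R. e x \<in> N}"
  have contr: "ideal (?contr N) R" if "submod K (e ` carrier R) N" for N
    by (rule submod_imp_ideal, rule submodI) (use submodD[OF that] in auto)
  have contr_img: "N = e ` ?contr N" if "N \<subseteq> e ` carrier R" for N using that by auto
  show "one_dim_local (fraction_field R) (frac_embed R ` carrier R) (frac_embed R ` \<mm>)"
    unfolding K_def[symmetric] e_def[symmetric]
  proof (rule one_dim_local.intro[OF K.field_axioms one_dim_local_axioms.intro])
    show "subring (e ` carrier R) K" by (rule A)
    fix x assume "x \<in> carrier K"
    then obtain a b where ab: "a \<in> carrier R" "b \<in> carrier R" "b \<noteq> \<zero>" "x = fraction R a b"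
      unfolding K_def by (rule frac_cases)
    have "e b \<otimes>\<^bsub>K\<^esub> x = e a"
      using ab by (simp add: e_def K_def frac_embed_def frac_mult frac_eq_iff m_comm)
    then show "\<exists>b\<in>e ` carrier R - {\<zero>\<^bsub>K\<^esub>}. b \<otimes>\<^bsub>K\<^esub> x \<in> e ` carrier R"
      using ab inj[of b \<zero>] by (intro bexI[of _ "e b"]) auto
  next
    fix \<C> assume C: "\<C> \<noteq> {}" "\<And>I. I \<in> \<C> \<Longrightarrow> submod K (e ` carrier R) I \<and> I \<subseteq> e ` carrier R"
    have "\<exists>M\<in>?contr ` \<C>. \<forall>I\<in>?contr ` \<C>. M \<subseteq> I \<longrightarrow> I = M"
      by (rule exists_maximal_ideal_in) (use C contr in auto)
    then obtain M where M: "M \<in> \<C>" "\<And>I. I \<in> \<C> \<Longrightarrow> ?contr M \<subseteq> ?contr I \<Longrightarrow> ?contr I = ?contr M"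
      by auto
    have "I = M" if I: "I \<in> \<C>" "M \<subseteq> I" for I
    proof -
      have "?contr I = ?contr M" using M(2)[OF I(1)] I(2) by blast
      moreover have "I = e ` ?contr I" "M = e ` ?contr M" using C(2) I(1) M(1) by (auto intro!: contr_img)
      ultimately show ?thesis by argo
    qed
    then show "\<exists>M\<in>\<C>. \<forall>I\<in>\<C>. M \<subseteq> I \<longrightarrow> I = M" using M(1) by blast
  next
    show "submod K (e ` carrier R) (e ` \<mm>)"
    proof (rule submodI)
      show "\<And>x. x \<in> e ` \<mm> \<Longrightarrow> x \<in> carrier K" using loc.Icarr by auto
      show "\<zero>\<^bsub>K\<^esub> \<in> e ` \<mm>" using loc.zero_closed e.hom_zero by (metis image_eqI)
      fix x assume "x \<in> e ` \<mm>"
      then obtain a where a: "a \<in> \<mm>" "x = e a" by blast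
      { fix y assume "y \<in> e ` \<mm>"
        then obtain b where b: "b \<in> \<mm>" "y = e b" by blast
        have "x \<oplus>\<^bsub>K\<^esub> y = e (a \<oplus> b)" using a b loc.Icarr by simp
        then show "x \<oplus>\<^bsub>K\<^esub> y \<in> e ` \<mm>" using a b loc.a_closed by blast }
      { fix y assume "y \<in> e ` carrier R"
        then obtain b where b: "b \<in> carrier R" "y = e b" by blast
        have "y \<otimes>\<^bsub>K\<^esub> x = e (b \<otimes> a)" using a b loc.Icarr by simp
        then show "y \<otimes>\<^bsub>K\<^esub> x \<in> e ` \<mm>" using a b loc.I_l_closed by blast }
    qed
    show "e ` \<mm> \<subseteq> e ` carrier R" using loc.Icarr by blast
    show "\<exists>x\<in>e ` \<mm>. x \<noteq> \<zero>\<^bsub>K\<^esub>" using w inj[of w \<zero>] loc.Icarr by auto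
    show "\<one>\<^bsub>K\<^esub> \<notin> e ` \<mm>" using one_m inj loc.Icarr e.hom_one one_closed by (metis imageE)
  next
    fix a assume "a \<in> e ` carrier R" "a \<notin> e ` \<mm>"
    then obtain r where r: "r \<in> carrier R" "r \<notin> \<mm>" "a = e r" by blast
    have "PIdl r = carrier R"
      using le_m[OF cgenideal_ideal[OF r(1)]] cgenideal_self[OF r(1)] r(2) by (metis subsetD)
    then have "\<one> \<in> PIdl r" by simp
    then obtain s where s: "s \<in> carrier R" "\<one> = s \<otimes> r" by (auto simp: cgenideal_def)
    then have "e s \<otimes>\<^bsub>K\<^esub> e r = \<one>\<^bsub>K\<^esub>" using r by (metis e.hom_mult e.hom_one)
    then show "\<exists>c\<in>e ` carrier R. c \<otimes>\<^bsub>K\<^esub> a = \<one>\<^bsub>K\<^esub>" using s r by blast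
  next
    fix P assume P: "submod K (e ` carrier R) P" "P \<subseteq> e ` carrier R" "\<exists>x\<in>P. x \<noteq> \<zero>\<^bsub>K\<^esub>" "\<one>\<^bsub>K\<^esub> \<notin> P"
      and prime: "\<And>a b. a \<in> e ` carrier R \<Longrightarrow> b \<in> e ` carrier R \<Longrightarrow> a \<otimes>\<^bsub>K\<^esub> b \<in> P \<Longrightarrow> a \<in> P \<or> b \<in> P"
    have "\<one> \<notin> ?contr P" using P(4) by simp
    then have proper: "carrier R \<noteq> ?contr P" using one_closed by metis
    have pr: "primeideal (?contr P) R"
    proof (rule primeidealI[OF contr[OF P(1)] is_cring])
      show "carrier R \<noteq> ?contr P" by (rule proper)
      show "a \<in> carrier R \<Longrightarrow> b \<in> carrier R \<Longrightarrow> a \<otimes> b \<in> ?contr P \<Longrightarrow> a \<in> ?contr P \<or> b \<in> ?contr P" for a b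
        using prime[of "e a" "e b"] by auto
    qed
    obtain x where x: "x \<in> carrier R" "e x \<in> P" "e x \<noteq> \<zero>\<^bsub>K\<^esub>" using P(2,3) by blast
    then have "x \<in> ?contr P - {\<zero>}" by auto
    moreover have "\<zero> \<in> ?contr P" using submodD(2)[OF P(1)] by simp
    ultimately have "{\<zero>} \<subset> ?contr P" by blast
    moreover have "?contr P \<subseteq> \<mm>" using le_m[OF contr[OF P(1)] proper[symmetric]] .
    ultimately have "?contr P = \<mm>"
      using krull_dim_one_chain[OF assms(3) zeroprimeideal pr m_prime] by blast
    then show "P = e ` \<mm>" using contr_img[OF P(2)] by simp
  next
    fix y x assume y: "y \<in> carrier K" "\<zero>\<^bsub>K\<^esub> \<in> monic_values K (e ` carrier R) y" and "x \<in> e ` \<mm>"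
    then obtain z where z: "z \<in> \<mm>" "x = e z" by blast
    \<comment> \<open>The element 1 is a root of X - 1, hence integral.\<close>
    have "\<one>\<^bsub>K\<^esub> \<otimes>\<^bsub>K\<^esub> \<one>\<^bsub>K\<^esub> \<oplus>\<^bsub>K\<^esub> \<ominus>\<^bsub>K\<^esub> \<one>\<^bsub>K\<^esub> \<in> monic_values K (e ` carrier R) \<one>\<^bsub>K\<^esub>"
      using subringE(3,5)[OF A] by (intro monic_values.intros) auto
    then have "integral_over K (e ` carrier R) \<one>\<^bsub>K\<^esub>"
      using K.monic_values_integral[OF A] by (simp add: K.r_neg)
    moreover have "integral_over K (e ` carrier R) y" using K.monic_values_integral[OF A y] .
    ultimately have "y \<otimes>\<^bsub>K\<^esub> e z \<in> e ` \<mm>"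
      using algebra_iso_End_mult[of \<mm> y z] assms(4) y z loc.Icarr
      unfolding K_def e_def one_step_normal_def by blast
    then show "y \<otimes>\<^bsub>K\<^esub> x \<in> e ` \<mm>" using z by simp
  qed
qed

theorem proposition4p5:
  fixes R :: "('a, 'b) ring_scheme" and \<mm> :: "'a set"
  assumes "noetherian_domain R"
    and "local_ring R \<mm>"
    and "adically_complete R \<mm>"
    and "krull_dim R = 1"
    and "one_step_normal R \<mm>"
  shows "module_iso R (ideal_module R \<mm>) (dual_module R (ideal_module R \<mm>))"
proof -
  interpret noetherian_domain R by fact
  interpret loc: local_ring R \<mm> by fact
  interpret K: one_dim_local "fraction_field R" "frac_embed R ` carrier R" "frac_embed R ` \<mm>"
    by (rule one_dim_local_fraction_field) fact+
  obtain x where "x \<in> \<mm>" "frac_embed R x \<noteq> \<zero>\<^bsub>fraction_field R\<^esub>" using K.m_nonzero by blast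
  then have ne: "\<exists>x\<in>\<mm>. x \<noteq> \<zero>\<^bsub>R\<^esub>" by (auto simp: frac_embed_def frac_zero)
  obtain u where u: "u \<in> carrier (fraction_field R) - {\<zero>\<^bsub>fraction_field R\<^esub>}"
    and eq: "frac_embed R ` \<mm> = (\<otimes>\<^bsub>fraction_field R\<^esub>) u ` {y \<in> carrier (fraction_field R).
      \<forall>x\<in>frac_embed R ` \<mm>. y \<otimes>\<^bsub>fraction_field R\<^esub> x \<in> frac_embed R ` carrier R}"
    using K.m_eq_dual by blast
  show ?thesis by (rule module_iso_dual[OF loc.is_ideal ne _ _ eq]) (use u in auto)
qed

end
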